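(* Let $(X,d_X)$ and $(Y,d_Y)$ be proper geodesic Gromov hyperbolic metric spaces, let $\lambda\ge 0$ and let $\phi\colon Y\to X$ be a $\lambda$-rough isometry. Let $\omega\in\partial_\infty Y$, $\omega'=\phi(\omega)\in\partial_\infty X$, $o\in Y$ and $o'=\phi(o)$. Let $b=b_{\omega,o}\colon Y\to\mathbb{R}$ and $b'=b_{\omega',o'}\colon X\to\mathbb{R}$ be the corresponding canonical Busemann functions, and for $\epsilon>0$ let $Y_\epsilon=(Y,d_\epsilon)$ and $X_\epsilon=(X,d_\epsilon)$ be the conformal deformations of $Y$ and $X$ with densities $\rho_\epsilon^Y=e^{-\epsilon b}$ and $\rho_\epsilon^X=e^{-\epsilon b'}$ respectively. If $X$ is roughly starlike with respect to $\omega'$ and $\epsilon>0$ is such that $X_\epsilon$ is a uniform space, then $Y_\epsilon$ is also a uniform space.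
   Context: Proper: closed balls are compact. Gromov product: $(x|y)_o=\frac12\left(d(x,o)+d(y,o)-d(x,y)\right)$. A metric space is $\delta$-hyperbolic ($\delta\ge0$) if $(x|y)_o\ge\min\{(x|z)_o,(z|y)_o\}-\delta$ for all points $x,y,z,o$; it is Gromov hyperbolic if it is $\delta$-hyperbolic for some $\delta\geq 0$. Gromov boundary: a sequence $(x_n)$ is a Gromov sequence if $(x_m|x_n)_o\to\infty$ as $m,n\to\infty$; Gromov sequences $(x_n)$, $(x_n')$ are equivalent if $(x_m|x_n')_o\to\infty$ as $m,n\to\infty$. $\partial_\infty X$ is the set of equivalence classes. For $\xi\in\partial_\infty X$ and $x,o\in X$, $(x|\xi)_o=(\xi|x)_o=\inf\{\liminf_{n\to\infty}(x|x_n)_o:(x_n)\in\xi\}$. Canonical Busemann function: $b_{\xi,o}(x)=(\xi|o)_x-(\xi|x)_o$. Rough isometry: $\phi\colon Y\to X$ is a $\lambda$-rough isometry if $d_Y(y_1,y_2)-\lambda\le d_X(\phi(y_1),\phi(y_2))\le d_Y(y_1,y_2)+\lambda$ for all $y_1,y_2\in Y$, and $\phi(Y)$ is $\tau$-dense in $X$ for some $\tau\geq 0$, i.e. every $x\in X$ satisfies $d_X(x,\phi(y))\le\tau$ for some $y\in Y$. Such a map sends Gromov sequences to Gromov sequences and induces a bijection $\partial_\infty Y\to\partial_\infty X$, also denoted $\phi$: $\phi(\omega)$ is the class of $(\phi(y_n))$ for any $(y_n)\in\omega$. Conformal deformation: for a density $\rho_\epsilon$ on a space $Z$ (here $Z=X$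 or $Y$), $d_\epsilon(x,x')=\inf_\gamma\int_\gamma\rho_\epsilon\,ds$, the infimum over curves $\gamma$ in $Z$ joining $x$ to $x'$ that are rectifiable with respect to the original metric of $Z$, with $ds$ the arclength of the original metric. Rough starlikeness: $X$ is $K$-roughly starlike ($K\ge0$) with respect to $\xi\in\partial_\infty X$ if for every $x\in X$ there exist $\zeta\in\partial_\infty X$ and a geodesic line $\gamma$ (isometric image of $\mathbb{R}$) joining $\xi$ and $\zeta$ with $\mathrm{dist}(x,\gamma)\le K$; roughly starlike means $K$-roughly starlike for some $K\ge0$. Uniform space: a locally compact, non-complete metric space $(Z,d)$ with metric boundary $\partial Z=\overline Z\setminus Z$ ($\overline Z$ the metric completion) is $A$-uniform if any two points $x,y\in Z$ can be joined by a rectifiable curve $\gamma$ with $l(\gamma)\le A\,d(x,y)$ and $\min\{l(\gamma[x,z]),l(\gamma[z,y])\}\le A\,\mathrm{dist}_d(z,\partial Z)$ for all $z\in\gamma$, where $\gamma[x,z]$ denotes the subcurve with endpoints $x,z$. It is uniform if it is $A$-uniform for some $A\ge1$. *)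

theory Defs
  imports "HOL-Analysis.Analysis"
begin

section \<open>Proper, geodesic and hyperbolic spaces\<close>

text \<open>
  The undeformed spaces are types of class \<^class>\<open>metric_space\<close>.  Properties of such a space as a
  whole are predicates on \<open>TYPE('a)\<close>.
\<close>

definition proper_space :: "'a::metric_space itself \<Rightarrow> bool" where
  "proper_space _ \<longleftrightarrow> (\<forall>(x::'a) r. compact (cball x r))"

definition geodesic_space :: "'a::metric_space itself \<Rightarrow> bool" where
  "geodesic_space _ \<longleftrightarrow>
     (\<forall>x y :: 'a. \<exists>\<gamma> :: real \<Rightarrow> 'a. \<gamma> 0 = x \<and> \<gamma> (dist x y) = y \<and>
        (\<forall>s\<in>{0..dist x y}. \<forall>t\<in>{0..dist x y}. dist (\<gamma> s) (\<gamma> t) = \<bar>s - t\<bar>))"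

definition gromov_product :: "'a::metric_space \<Rightarrow> 'a \<Rightarrow> 'a \<Rightarrow> real" where
  "gromov_product p x y = (dist x p + dist y p - dist x y) / 2"

definition delta_hyperbolic :: "real \<Rightarrow> 'a::metric_space itself \<Rightarrow> bool" where
  "delta_hyperbolic \<delta> _ \<longleftrightarrow>
     (\<forall>x y z p :: 'a.
        gromov_product p x y \<ge> min (gromov_product p x z) (gromov_product p z y) - \<delta>)"

definition gromov_hyperbolic :: "'a::metric_space itself \<Rightarrow> bool" where
  "gromov_hyperbolic T \<longleftrightarrow> (\<exists>\<delta>\<ge>0. delta_hyperbolic \<delta> T)"

section \<open>The Gromov boundary\<close>

text \<open>
  The definitions below quantify over all base points; whether the limits are infinite does not
  depend on the base point.
\<close>

definition gromov_sequence :: "(nat \<Rightarrow> 'a::metric_space) \<Rightarrow> bool" where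
  "gromov_sequence u \<longleftrightarrow>
     (\<forall>p. filterlim (\<lambda>(m, n). gromov_product p (u m) (u n)) at_top (sequentially \<times>\<^sub>F sequentially))"

definition gromov_rel :: "((nat \<Rightarrow> 'a::metric_space) \<times> (nat \<Rightarrow> 'a)) set" where
  "gromov_rel =
     {(u, v). gromov_sequence u \<and> gromov_sequence v \<and>
        (\<forall>p. filterlim (\<lambda>(m, n). gromov_product p (u m) (v n)) at_top
               (sequentially \<times>\<^sub>F sequentially))}"

definition gromov_boundary :: "(nat \<Rightarrow> 'a::metric_space) set set" where
  "gromov_boundary = Collect gromov_sequence // gromov_rel"

text \<open>
  \<open>(x|\<xi>)\<^sub>p\<close> with base point \<open>p\<close>.  The infimum and the lower limits are taken in \<^typ>\<open>ereal\<close>; for a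
  boundary point \<open>\<xi>\<close> the result lies in \<open>[0, dist x p]\<close>, so the conversion loses nothing.
\<close>

definition gromov_product_bdry ::
    "'a::metric_space \<Rightarrow> 'a \<Rightarrow> (nat \<Rightarrow> 'a) set \<Rightarrow> real" where
  "gromov_product_bdry p x \<xi> =
     real_of_ereal (INF u\<in>\<xi>. liminf (\<lambda>n. ereal (gromov_product p x (u n))))"

definition busemann :: "(nat \<Rightarrow> 'a::metric_space) set \<Rightarrow> 'a \<Rightarrow> 'a \<Rightarrow> real" where
  "busemann \<xi> p x = gromov_product_bdry x p \<xi> - gromov_product_bdry p x \<xi>"

section \<open>Rough isometries and rough starlikeness\<close>

definition rough_isometry :: "real \<Rightarrow> ('b::metric_space \<Rightarrow> 'a::metric_space) \<Rightarrow> bool" where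
  "rough_isometry l \<phi> \<longleftrightarrow>
     (\<forall>y1 y2. dist y1 y2 - l \<le> dist (\<phi> y1) (\<phi> y2) \<and> dist (\<phi> y1) (\<phi> y2) \<le> dist y1 y2 + l) \<and>
     (\<exists>\<tau>\<ge>0. \<forall>x. \<exists>y. dist x (\<phi> y) \<le> \<tau>)"

text \<open>
  All sequences \<open>\<phi> \<circ> u\<close> with \<open>u \<in> \<omega>\<close> have the same class, so the union is that single class.
\<close>

definition boundary_map ::
    "('b::metric_space \<Rightarrow> 'a::metric_space) \<Rightarrow> (nat \<Rightarrow> 'b) set \<Rightarrow> (nat \<Rightarrow> 'a) set" where
  "boundary_map \<phi> \<omega> = (\<Union>u\<in>\<omega>. gromov_rel `` {\<phi> \<circ> u})"

definition geodesic_line_joining ::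
    "(real \<Rightarrow> 'a::metric_space) \<Rightarrow> (nat \<Rightarrow> 'a) set \<Rightarrow> (nat \<Rightarrow> 'a) set \<Rightarrow> bool" where
  "geodesic_line_joining \<gamma> \<xi> \<zeta> \<longleftrightarrow>
     (\<forall>s t. dist (\<gamma> s) (\<gamma> t) = \<bar>s - t\<bar>) \<and>
     (\<lambda>n. \<gamma> (- real n)) \<in> \<xi> \<and> (\<lambda>n. \<gamma> (real n)) \<in> \<zeta>"

definition roughly_starlike_with ::
    "real \<Rightarrow> (nat \<Rightarrow> 'a::metric_space) set \<Rightarrow> bool" where
  "roughly_starlike_with K \<xi> \<longleftrightarrow>
     (\<forall>x. \<exists>\<zeta>\<in>gromov_boundary. \<exists>\<gamma>. geodesic_line_joining \<gamma> \<xi> \<zeta> \<and> infdist x (range \<gamma>) \<le> K)"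

definition roughly_starlike :: "(nat \<Rightarrow> 'a::metric_space) set \<Rightarrow> bool" where
  "roughly_starlike \<xi> \<longleftrightarrow> (\<exists>K\<ge>0. roughly_starlike_with K \<xi>)"

section \<open>Curves, length and conformal deformation\<close>

text \<open>
  Curves are parametrized by \<open>[0, 1]\<close>.  The distance is an explicit argument, because lengths are
  needed both for the original and for the deformed metric.  \<open>curve_length d \<gamma> a b\<close> is the length
  of the restriction of \<open>\<gamma>\<close> to \<open>[a, b]\<close>, possibly infinite.
\<close>

definition curve_length :: "('a \<Rightarrow> 'a \<Rightarrow> real) \<Rightarrow> (real \<Rightarrow> 'a) \<Rightarrow> real \<Rightarrow> real \<Rightarrow> ennreal" where
  "curve_length d \<gamma> a b =
     Sup {(\<Sum>i<n. ennreal (d (\<gamma> (t i)) (\<gamma> (t (Suc i))))) | (n::nat) (t :: nat \<Rightarrow> real).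
            t 0 = a \<and> t n = b \<and> (\<forall>i<n. t i \<le> t (Suc i))}"

definition rectifiable_curve ::
    "'a set \<Rightarrow> ('a \<Rightarrow> 'a \<Rightarrow> real) \<Rightarrow> (real \<Rightarrow> 'a) \<Rightarrow> 'a \<Rightarrow> 'a \<Rightarrow> bool" where
  "rectifiable_curve M d \<gamma> x y \<longleftrightarrow>
     pathin (Metric_space.mtopology M d) \<gamma> \<and> \<gamma> 0 = x \<and> \<gamma> 1 = y \<and> curve_length d \<gamma> 0 1 < \<infinity>"

text \<open>
  The arclength parametrization of a rectifiable curve, on \<open>[0, l]\<close> where \<open>l\<close> is its length.  Every
  parameter \<open>t\<close> at which the length function takes the value \<open>s\<close> gives the same point \<open>\<gamma> t\<close>.
\<close>

definition arclength_param :: "('a \<Rightarrow> 'a \<Rightarrow> real) \<Rightarrow> (real \<Rightarrow> 'a) \<Rightarrow> real \<Rightarrow> 'a" where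
  "arclength_param d \<gamma> s = \<gamma> (SOME t. t \<in> {0..1} \<and> curve_length d \<gamma> 0 t = ennreal s)"

definition arclength_integral ::
    "('a \<Rightarrow> 'a \<Rightarrow> real) \<Rightarrow> ('a \<Rightarrow> real) \<Rightarrow> (real \<Rightarrow> 'a) \<Rightarrow> real" where
  "arclength_integral d \<rho> \<gamma> =
     integral {0..enn2real (curve_length d \<gamma> 0 1)} (\<lambda>s. \<rho> (arclength_param d \<gamma> s))"

definition conformal_dist :: "('a::metric_space \<Rightarrow> real) \<Rightarrow> 'a \<Rightarrow> 'a \<Rightarrow> real" where
  "conformal_dist \<rho> x y =
     (INF \<gamma>\<in>{\<gamma>. rectifiable_curve UNIV dist \<gamma> x y}. arclength_integral dist \<rho> \<gamma>)"

section \<open>Metric completion and uniform spaces\<close>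

definition cauchy_rel ::
    "'a set \<Rightarrow> ('a \<Rightarrow> 'a \<Rightarrow> real) \<Rightarrow> ((nat \<Rightarrow> 'a) \<times> (nat \<Rightarrow> 'a)) set" where
  "cauchy_rel M d =
     {(u, v). Metric_space.MCauchy M d u \<and> Metric_space.MCauchy M d v \<and>
        (\<lambda>n. d (u n) (v n)) \<longlonglongrightarrow> 0}"

definition completion :: "'a set \<Rightarrow> ('a \<Rightarrow> 'a \<Rightarrow> real) \<Rightarrow> (nat \<Rightarrow> 'a) set set" where
  "completion M d = Collect (Metric_space.MCauchy M d) // cauchy_rel M d"

definition completion_dist ::
    "('a \<Rightarrow> 'a \<Rightarrow> real) \<Rightarrow> (nat \<Rightarrow> 'a) set \<Rightarrow> (nat \<Rightarrow> 'a) set \<Rightarrow> real" where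
  "completion_dist d P Q = (THE r. \<forall>u\<in>P. \<forall>v\<in>Q. (\<lambda>n. d (u n) (v n)) \<longlonglongrightarrow> r)"

definition completion_embed :: "'a set \<Rightarrow> ('a \<Rightarrow> 'a \<Rightarrow> real) \<Rightarrow> 'a \<Rightarrow> (nat \<Rightarrow> 'a) set" where
  "completion_embed M d z = cauchy_rel M d `` {\<lambda>n. z}"

definition metric_boundary :: "'a set \<Rightarrow> ('a \<Rightarrow> 'a \<Rightarrow> real) \<Rightarrow> (nat \<Rightarrow> 'a) set set" where
  "metric_boundary M d = completion M d - completion_embed M d ` M"

definition dist_to_boundary :: "'a set \<Rightarrow> ('a \<Rightarrow> 'a \<Rightarrow> real) \<Rightarrow> 'a \<Rightarrow> real" where
  "dist_to_boundary M d z =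
     (INF P\<in>metric_boundary M d. completion_dist d (completion_embed M d z) P)"

definition uniform_metric_space_with :: "real \<Rightarrow> 'a set \<Rightarrow> ('a \<Rightarrow> 'a \<Rightarrow> real) \<Rightarrow> bool" where
  "uniform_metric_space_with A M d \<longleftrightarrow>
     Metric_space M d \<and>
     locally_compact_space (Metric_space.mtopology M d) \<and>
     \<not> Metric_space.mcomplete M d \<and>
     (\<forall>x\<in>M. \<forall>y\<in>M. \<exists>\<gamma>. rectifiable_curve M d \<gamma> x y \<and>
        curve_length d \<gamma> 0 1 \<le> ennreal (A * d x y) \<and>
        (\<forall>t\<in>{0..1}. min (curve_length d \<gamma> 0 t) (curve_length d \<gamma> t 1)
                      \<le> ennreal (A * dist_to_boundary M d (\<gamma> t))))"

definition uniform_metric_space :: "'a set \<Rightarrow> ('a \<Rightarrow> 'a \<Rightarrow> real) \<Rightarrow> bool" where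
  "uniform_metric_space M d \<longleftrightarrow> (\<exists>A\<ge>1. uniform_metric_space_with A M d)"

end

theory Submission
  imports Defs
begin

text \<open>
  Write \<open>\<rho> = exp (- \<epsilon> * b)\<close> for either density.  Three properties of canonical Busemann functions
  enter.  First, \<open>b\<close> is 2-Lipschitz, so \<open>\<rho>\<close> satisfies a Harnack inequality: it changes by a
  bounded factor over bounded distances.  Secondly, \<open>b x\<close> differs by a bounded amount from
  \<open>d(u\<^sub>n, x) - d(u\<^sub>n, o)\<close> for large \<open>n\<close>, whichever sequence \<open>u\<close> represents the boundary point;
  applied to \<open>u\<close> and \<open>\<phi> \<circ> u\<close> this shows that \<open>b\<close> and \<open>b' \<circ> \<phi>\<close> differ by a bounded amount
  (\<open>busemann_rough_isometry\<close>), hence the two densities are comparable along \<open>\<phi>\<close>.  Thirdly, \<open>b'\<close> grows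
  at unit speed, up to a bounded error, along geodesic lines that start at \<open>\<omega>'\<close> (\<open>busemann_line\<close>).

  From the Harnack inequality, travelling a distance of order one near \<open>x\<close> costs about \<open>\<rho> x\<close> in the
  deformed metric, and points at distance at least one are at deformed distance at least a multiple
  of \<open>\<rho> x\<close>.  Consequently the deformation keeps the topology, and the deformed distance from \<open>x\<close> to
  the metric boundary is at least a multiple of \<open>\<rho> x\<close>, because a deformed ball of that size lies in
  a compact ball.  In \<open>X\<close> it is also at most a multiple of \<open>\<rho> x\<close>: by rough starlikeness a line
  passes near \<open>x\<close>, and \<open>\<rho>\<close> decays geometrically along it, so that its far end lies on the boundary
  at deformed distance about \<open>\<rho> x\<close>.  The quasi-preimage of such a line in \<open>Y\<close> is a Cauchy sequence
  without limit, so the deformation of \<open>Y\<close> is not complete.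

  Uniformity is then a statement about discrete chains, which \<open>\<phi>\<close> transports.  Given \<open>y\<close> and \<open>y'\<close> in
  \<open>Y\<close> that are far apart, cut a uniform curve from \<open>\<phi> y\<close> to \<open>\<phi> y'\<close> into pieces whose endpoints are at
  distance one, lift the cutting points to \<open>Y\<close>, and join consecutive lifts by geodesics.  A piece that
  starts at \<open>x\<close> has deformed length at least a multiple of \<open>\<rho>\<^sub>X x\<close>, and its lift has deformed length
  at most a multiple of \<open>\<rho>\<^sub>X x\<close>.  So the lifted curve is controlled piece by piece by the original
  one, and both distances to the boundary are comparable to the densities
  (\<open>uniform_curve_far\<close>).  The deformed distance of \<open>\<phi> y\<close> and \<open>\<phi> y'\<close> is bounded by that of
  \<open>y\<close> and \<open>y'\<close> by the same discretization in the other direction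
  (\<open>conformal_dist_image_le\<close>).  For \<open>y\<close> and \<open>y'\<close> at bounded distance a geodesic is a uniform curve.
\<close>

section \<open>Length of curves and arclength\<close>

lemma sum_le_curve_length:
  assumes "t 0 = a" "t n = b" "\<And>i. i < n \<Longrightarrow> t i \<le> t (Suc i)"
  shows "(\<Sum>i<n. ennreal (d (\<gamma> (t i)) (\<gamma> (t (Suc i))))) \<le> curve_length d \<gamma> a b"
  unfolding curve_length_def by (rule Sup_upper) (use assms in blast)

lemma curve_length_least:
  assumes "\<And>n t. t 0 = a \<Longrightarrow> t n = b \<Longrightarrow> (\<And>i. i < n \<Longrightarrow> t i \<le> t (Suc i)) \<Longrightarrow>
    (\<Sum>i<n. ennreal (d (\<gamma> (t i)) (\<gamma> (t (Suc i))))) \<le> C"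
  shows "curve_length d \<gamma> a b \<le> C"
  unfolding curve_length_def by (rule Sup_least) (use assms in blast)

lemma partition_mono:
  fixes t :: "nat \<Rightarrow> real"
  assumes "\<And>i. i < n \<Longrightarrow> t i \<le> t (Suc i)" "i \<le> j" "j \<le> n"
  shows "t i \<le> t j"
  using assms(2,3)
proof (induction j rule: dec_induct)
  case (step m)
  then show ?case using assms(1)[of m] by simp
qed simp

text \<open>
  With \<open>F\<close> linear this bounds the length of a Lipschitz curve; with \<open>F\<close> the integral of the density
  it bounds the deformed length.
\<close>

lemma curve_length_le_increment:
  assumes "\<And>s t. a \<le> s \<Longrightarrow> s \<le> t \<Longrightarrow> t \<le> b \<Longrightarrow> d (\<gamma> s) (\<gamma> t) \<le> F t - F s"
    and mono: "\<And>s t. a \<le> s \<Longrightarrow> s \<le> t \<Longrightarrow> t \<le> b \<Longrightarrow> F s \<le> F t"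
  shows "curve_length d \<gamma> a b \<le> ennreal (F b - F a)"
proof (rule curve_length_least)
  fix n and t :: "nat \<Rightarrow> real"
  assume t: "t 0 = a" "t n = b" "\<And>i. i < n \<Longrightarrow> t i \<le> t (Suc i)"
  have rng: "a \<le> t i" "t i \<le> b" if "i \<le> n" for i
    using partition_mono[where t = t and n = n and i = 0 and j = i, OF t(3)]
      partition_mono[where t = t and n = n and i = i and j = n, OF t(3)] t that by auto
  have "(\<Sum>i<n. ennreal (d (\<gamma> (t i)) (\<gamma> (t (Suc i))))) \<le> (\<Sum>i<n. ennreal (F (t (Suc i)) - F (t i)))"
    by (intro sum_mono ennreal_leI assms(1)) (use rng t(3) in auto)
  also have "\<dots> = ennreal (\<Sum>i<n. F (t (Suc i)) - F (t i))"
    by (rule sum_ennreal) (use rng t(3) mono in auto)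
  also have "(\<Sum>i<n. F (t (Suc i)) - F (t i)) = F b - F a"
    using sum_lessThan_telescope[of "\<lambda>i. F (t i)" n] t by simp
  finally show "(\<Sum>i<n. ennreal (d (\<gamma> (t i)) (\<gamma> (t (Suc i))))) \<le> ennreal (F b - F a)" .
qed

lemma curve_length_superadditive:
  assumes "a \<le> b" "b \<le> c"
  shows "curve_length d \<gamma> a b + curve_length d \<gamma> b c \<le> curve_length d \<gamma> a c"
proof -
  define S where "S a b = {(\<Sum>i<n. ennreal (d (\<gamma> (t i)) (\<gamma> (t (Suc i))))) | (n::nat) (t :: nat \<Rightarrow> real).
            t 0 = a \<and> t n = b \<and> (\<forall>i<n. t i \<le> t (Suc i))}" for a b
  have S: "curve_length d \<gamma> a b = (SUP s\<in>S a b. s)" for a b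
    by (simp add: curve_length_def S_def)
  have ne: "S a b \<noteq> {}" if "a \<le> b" for a b
    unfolding S_def using that
    by (auto intro!: exI[of _ "1::nat"] exI[of _ "\<lambda>i. if i = 0 then a else b"])
  have "p + q \<le> curve_length d \<gamma> a c" if "p \<in> S a b" "q \<in> S b c" for p q
  proof -
    from that(1) obtain n t where t: "t 0 = a" "t n = b" "\<And>i. i < n \<Longrightarrow> t i \<le> t (Suc i)"
      and p: "p = (\<Sum>i<n. ennreal (d (\<gamma> (t i)) (\<gamma> (t (Suc i)))))" unfolding S_def by blast
    from that(2) obtain m u where u: "u 0 = b" "u m = c" "\<And>i. i < m \<Longrightarrow> u i \<le> u (Suc i)"
      and q: "q = (\<Sum>i<m. ennreal (d (\<gamma> (u i)) (\<gamma> (u (Suc i)))))" unfolding S_def by blast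
    define w where "w i = (if i \<le> n then t i else u (i - n))" for i
    have w2: "w (n + i) = u i" for i using t u by (auto simp: w_def)
    have "p + q = (\<Sum>i<n+m. ennreal (d (\<gamma> (w i)) (\<gamma> (w (Suc i)))))"
    proof -
      have "(\<Sum>i<n+m. ennreal (d (\<gamma> (w i)) (\<gamma> (w (Suc i)))))
          = (\<Sum>i<n. ennreal (d (\<gamma> (w i)) (\<gamma> (w (Suc i)))))
            + (\<Sum>i<m. ennreal (d (\<gamma> (w (n + i))) (\<gamma> (w (n + Suc i)))))"
        by (induction m) (simp_all add: add.assoc)
      moreover have "(\<Sum>i<n. ennreal (d (\<gamma> (w i)) (\<gamma> (w (Suc i))))) = p"
        unfolding p by (rule sum.cong) (auto simp: w_def)
      ultimately show ?thesis unfolding w2 q by simp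
    qed
    also have "\<dots> \<le> curve_length d \<gamma> a c"
    proof (rule sum_le_curve_length)
      show "w 0 = a" by (simp add: w_def t)
      show "w (n + m) = c" by (simp add: w2 u)
      fix i assume i: "i < n + m"
      show "w i \<le> w (Suc i)"
      proof (cases "i < n")
        case True then show ?thesis by (simp add: w_def t)
      next
        case False
        then obtain j where "i = n + j" using le_Suc_ex not_less by blast
        then show ?thesis using i w2[of j] w2[of "Suc j"] u(3)[of j] by simp
      qed
    qed
    finally show ?thesis .
  qed
  then have "p + curve_length d \<gamma> b c \<le> curve_length d \<gamma> a c" if "p \<in> S a b" for p
    unfolding S[of b c] ennreal_SUP_add_right[OF ne[OF assms(2)]]
    by (intro SUP_least) (use that in auto)
  then show ?thesis
    unfolding S[of a b] ennreal_SUP_add_left[OF ne[OF assms(1)], symmetric]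
    by (intro SUP_least) auto
qed

lemma le_curve_length: "a \<le> b \<Longrightarrow> ennreal (d (\<gamma> a) (\<gamma> b)) \<le> curve_length d \<gamma> a b"
  using sum_le_curve_length[of "\<lambda>i. if i = 0 then a else b" a 1 b d \<gamma>] by simp

lemma curve_length_point:
  assumes "\<And>x. d x x = 0" shows "curve_length d \<gamma> a a = 0"
proof -
  have "curve_length d \<gamma> a a \<le> 0"
  proof (rule curve_length_least)
    fix n and t :: "nat \<Rightarrow> real"
    assume t: "t 0 = a" "t n = a" "\<And>i. i < n \<Longrightarrow> t i \<le> t (Suc i)"
    have "t i = a" if "i \<le> n" for i
      using partition_mono[where t = t and n = n and i = 0 and j = i, OF t(3)]
      partition_mono[where t = t and n = n and i = i and j = n, OF t(3)] t that by auto
    then show "(\<Sum>i<n. ennreal (d (\<gamma> (t i)) (\<gamma> (t (Suc i))))) \<le> 0" using assms by simp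
  qed
  then show ?thesis by simp
qed

text \<open>
  A partition whose length sum is within \<open>\<eta>\<close> of the full length gives, by truncation at \<open>t\<close>, a
  continuous function \<open>V\<close>.  From \<open>s\<close> to \<open>t\<close> it increases by at most a partition sum for that piece,
  hence by at most the length of the piece.  So the error of \<open>V\<close> is nondecreasing in \<open>t\<close>, and it is
  at most \<open>\<eta>\<close> everywhere because it is at most \<open>\<eta>\<close> at \<open>1\<close>.
\<close>

lemma length_function_approx:
  fixes \<gamma> :: "real \<Rightarrow> 'a::metric_space"
  assumes cont: "continuous_on {0..1} \<gamma>" and fin: "curve_length dist \<gamma> 0 1 < \<infinity>" and "\<eta> > 0"
  shows "\<exists>V. continuous_on {0..1} V \<and>
    (\<forall>t\<in>{0..1}. V t \<le> enn2real (curve_length dist \<gamma> 0 t)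
        \<and> enn2real (curve_length dist \<gamma> 0 t) \<le> V t + \<eta>) \<and>
    (\<forall>s t. 0 \<le> s \<longrightarrow> s \<le> t \<longrightarrow> t \<le> 1 \<longrightarrow> ennreal (V t - V s) \<le> curve_length dist \<gamma> s t)"
proof -
  let ?l = "\<lambda>s t. curve_length dist \<gamma> s t"
  have fin2: "?l s t < \<infinity>" if "0 \<le> s" "s \<le> t" "t \<le> 1" for s t
  proof -
    have "?l 0 s + ?l s t + ?l t 1 \<le> ?l 0 1"
    proof -
      have "?l 0 s + ?l s t + ?l t 1 \<le> ?l 0 t + ?l t 1"
        by (rule add_right_mono, rule curve_length_superadditive) (use that in auto)
      also have "\<dots> \<le> ?l 0 1" by (rule curve_length_superadditive) (use that in auto)
      finally show ?thesis .
    qed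
    then show ?thesis using fin by (auto simp: less_top[symmetric] top_unique)
  qed
  define v where "v t = enn2real (?l 0 t)" for t
  have v: "ennreal (v t) = ?l 0 t" if "0 \<le> t" "t \<le> 1" for t
    using fin2[of 0 t] that by (simp add: v_def less_top)
  have "\<exists>n t. (t 0 = 0 \<and> t n = 1 \<and> (\<forall>i<n. t i \<le> t (Suc i))) \<and>
     v 1 - \<eta> \<le> (\<Sum>i<n. dist (\<gamma> (t i)) (\<gamma> (t (Suc i))))"
  proof (rule ccontr)
    assume "\<not> ?thesis"
    then have no: "(\<Sum>i<n. dist (\<gamma> (t i)) (\<gamma> (t (Suc i)))) < v 1 - \<eta>"
      if "t 0 = 0 \<and> t n = 1 \<and> (\<forall>i<n. t i \<le> t (Suc i))" for n t
      using that not_le by blast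
    have "?l 0 1 \<le> ennreal (v 1 - \<eta>)"
    proof (rule curve_length_least)
      fix n and t :: "nat \<Rightarrow> real"
      assume t: "t 0 = 0" "t n = 1" "\<And>i. i < n \<Longrightarrow> t i \<le> t (Suc i)"
      then have "(\<Sum>i<n. dist (\<gamma> (t i)) (\<gamma> (t (Suc i)))) < v 1 - \<eta>"
        by (intro no) simp
      then show "(\<Sum>i<n. ennreal (dist (\<gamma> (t i)) (\<gamma> (t (Suc i))))) \<le> ennreal (v 1 - \<eta>)"
        by (simp add: sum_ennreal ennreal_leI)
    qed
    then have *: "ennreal (v 1) \<le> ennreal (v 1 - \<eta>)" using v[of 1] by simp
    have "dist (\<gamma> 0) (\<gamma> 1) < v 1 - \<eta>"
      using no[of "\<lambda>i. if i = 0 then 0 else 1" 1] by simp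
    then have "0 \<le> v 1 - \<eta>" using zero_le_dist[of "\<gamma> 0" "\<gamma> 1"] by linarith
    then have "v 1 \<le> v 1 - \<eta>" using * by simp
    then show False using \<open>\<eta> > 0\<close> by simp
  qed
  then obtain n t where t: "t 0 = 0" "t n = 1" "\<And>i. i < n \<Longrightarrow> t i \<le> t (Suc i)"
    and tn: "v 1 - \<eta> \<le> (\<Sum>i<n. dist (\<gamma> (t i)) (\<gamma> (t (Suc i))))" by blast
  have rng: "0 \<le> t i" "t i \<le> 1" if "i \<le> n" for i
    using partition_mono[where t = t and n = n and i = 0 and j = i, OF t(3)]
      partition_mono[where t = t and n = n and i = i and j = n, OF t(3)] t that by auto
  define V where "V s = (\<Sum>i<n. dist (\<gamma> (min s (t i))) (\<gamma> (min s (t (Suc i)))))" for s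
  have contV: "continuous_on {0..1} V"
    unfolding V_def
    by (intro continuous_intros continuous_on_compose2[OF cont]) (auto simp: rng min_le_iff_disj)
  have inc: "ennreal (V s' - V s) \<le> ?l s s'" if "0 \<le> s" "s \<le> s'" "s' \<le> 1" for s s'
  proof -
    define m where "m u = max s (min s' u)" for u
    have tri: "dist (\<gamma> (min s' u)) (\<gamma> (min s' w)) \<le>
       dist (\<gamma> (min s u)) (\<gamma> (min s w)) + dist (\<gamma> (m u)) (\<gamma> (m w))" if "u \<le> w" for u w
    proof -
      consider "w \<le> s" | "s \<le> u" | "u < s" "s < w" by linarith
      then show ?thesis
      proof cases
        case 3
        then have "min s u = u" "min s w = s" "m u = s" "m w = min s' w" "min s' u = u"
          using \<open>s \<le> s'\<close> by (auto simp: m_def)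
        then show ?thesis by (metis dist_triangle)
      qed (use \<open>u \<le> w\<close> \<open>s \<le> s'\<close> in \<open>auto simp: m_def min_def max_def\<close>)
    qed
    have "V s' \<le> V s + (\<Sum>i<n. dist (\<gamma> (m (t i))) (\<gamma> (m (t (Suc i)))))"
      unfolding V_def sum.distrib[symmetric] by (intro sum_mono tri) (use t in auto)
    then have "ennreal (V s' - V s) \<le> ennreal (\<Sum>i<n. dist (\<gamma> (m (t i))) (\<gamma> (m (t (Suc i)))))"
      by (intro ennreal_leI) simp
    also have "\<dots> = (\<Sum>i<n. ennreal (dist (\<gamma> (m (t i))) (\<gamma> (m (t (Suc i))))))"
      by (simp add: sum_ennreal)
    also have "\<dots> \<le> ?l s s'"
    proof (rule sum_le_curve_length[where t = "\<lambda>i. m (t i)"])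
      show "m (t 0) = s" "m (t n) = s'" using that by (auto simp: m_def t)
      show "m (t i) \<le> m (t (Suc i))" if "i < n" for i
        using t(3)[OF that] by (auto simp: m_def min_def max_def)
    qed
    finally show ?thesis .
  qed
  have diff: "V s' - V s \<le> v s' - v s" if "0 \<le> s" "s \<le> s'" "s' \<le> 1" for s s'
  proof -
    have "ennreal (v s + max 0 (V s' - V s)) = ennreal (v s) + ennreal (V s' - V s)"
      by (simp add: v_def ennreal_plus max_def ennreal_neg)
    also have "\<dots> \<le> ?l 0 s + ?l s s'" using v[of s] inc[OF that] that by (simp add: add_left_mono)
    also have "\<dots> \<le> ennreal (v s')" using curve_length_superadditive[of 0 s s' dist \<gamma>] v[of s'] that by simp
    finally have "v s + max 0 (V s' - V s) \<le> v s'"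
      by (subst (asm) ennreal_le_iff) (auto simp: v_def)
    then show ?thesis by linarith
  qed
  have V0: "V 0 = 0" using rng by (auto simp: V_def min_def intro!: sum.neutral)
  have V1: "V 1 = (\<Sum>i<n. dist (\<gamma> (t i)) (\<gamma> (t (Suc i))))"
  proof -
    have "min 1 (t i) = t i" if "i \<le> n" for i using rng(2)[OF that] by simp
    then show ?thesis unfolding V_def by (intro sum.cong) auto
  qed
  have v0: "v 0 = 0" by (simp add: v_def curve_length_point)
  have "\<forall>t\<in>{0..1}. V t \<le> v t \<and> v t \<le> V t + \<eta>"
  proof
    fix t :: real assume "t \<in> {0..1}"
    then show "V t \<le> v t \<and> v t \<le> V t + \<eta>"
      using diff[of 0 t] diff[of t 1] V0 v0 V1 tn by simp
  qed
  then show ?thesis using contV inc unfolding v_def by blast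
qed

text \<open>
  The approximations make the length function a uniform limit of continuous functions.  They also
  carry an upper bound for the length of a piece over to the increment of the length function,
  which is half of the additivity of length.
\<close>

lemma length_function:
  fixes \<gamma> :: "real \<Rightarrow> 'a::metric_space"
  assumes cont: "continuous_on {0..1} \<gamma>" and fin: "curve_length dist \<gamma> 0 1 < \<infinity>"
  defines "v \<equiv> \<lambda>t. enn2real (curve_length dist \<gamma> 0 t)"
  shows ennreal_length_function: "\<And>t. t \<in> {0..1} \<Longrightarrow> curve_length dist \<gamma> 0 t = ennreal (v t)"
    and length_function_ge_dist: "\<And>s t. 0 \<le> s \<Longrightarrow> s \<le> t \<Longrightarrow> t \<le> 1 \<Longrightarrow> dist (\<gamma> s) (\<gamma> t) \<le> v t - v s"
    and length_function_le: "\<And>s t C. 0 \<le> s \<Longrightarrow> s \<le> t \<Longrightarrow> t \<le> 1 \<Longrightarrow> 0 \<le> C \<Longrightarrow>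
      curve_length dist \<gamma> s t \<le> ennreal C \<Longrightarrow> v t - v s \<le> C"
    and continuous_on_length_function: "continuous_on {0..1} v"
    and length_function_0: "v 0 = 0"
proof -
  let ?l = "\<lambda>s t. curve_length dist \<gamma> s t"
  show lv: "?l 0 t = ennreal (v t)" if "t \<in> {0..1}" for t
  proof -
    have "?l 0 t \<le> ?l 0 t + ?l t 1" by simp
    also have "\<dots> \<le> ?l 0 1" by (rule curve_length_superadditive) (use that in auto)
    finally have "?l 0 t \<le> ?l 0 1" .
    then have "?l 0 t < top" using fin by (simp add: le_less_trans)
    then show ?thesis by (simp add: v_def)
  qed
  show "dist (\<gamma> s) (\<gamma> t) \<le> v t - v s" if "0 \<le> s" "s \<le> t" "t \<le> 1" for s t
  proof -
    have "ennreal (v s) + ennreal (dist (\<gamma> s) (\<gamma> t)) \<le> ?l 0 s + ?l s t"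
      using le_curve_length[of s t dist \<gamma>] lv[of s] that by (simp add: add_left_mono)
    also have "\<dots> \<le> ennreal (v t)" using curve_length_superadditive[of 0 s t dist \<gamma>] lv[of t] that by simp
    finally have "ennreal (v s + dist (\<gamma> s) (\<gamma> t)) \<le> ennreal (v t)"
      by (simp add: v_def)
    then show ?thesis by (subst (asm) ennreal_le_iff) (auto simp: v_def)
  qed
  show "v t - v s \<le> C" if "0 \<le> s" "s \<le> t" "t \<le> 1" "0 \<le> C" "?l s t \<le> ennreal C" for s t C
  proof (rule field_le_epsilon)
    fix \<eta> :: real assume "\<eta> > 0"
    obtain V where V: "\<forall>t\<in>{0..1}. V t \<le> v t \<and> v t \<le> V t + \<eta>"
        "\<forall>s t. 0 \<le> s \<longrightarrow> s \<le> t \<longrightarrow> t \<le> 1 \<longrightarrow> ennreal (V t - V s) \<le> ?l s t"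
      using length_function_approx[OF cont fin \<open>\<eta> > 0\<close>] unfolding v_def by blast
    have "V s \<le> v s" "v t \<le> V t + \<eta>" "ennreal (V t - V s) \<le> ?l s t"
      using V that by auto
    moreover have "V t - V s \<le> C"
      using order_trans[OF \<open>ennreal (V t - V s) \<le> ?l s t\<close> that(5)] that(4) by simp
    ultimately show "v t - v s \<le> C + \<eta>" by linarith
  qed
  show "continuous_on {0..1} v"
  proof -
    let ?P = "\<lambda>n V. continuous_on {0..1} V \<and> (\<forall>t\<in>{0..1}. \<bar>v t - V t\<bar> \<le> inverse (real (Suc n)))"
    have "\<exists>V. ?P n V" for n
    proof -
      have pos: "0 < inverse (real (Suc n))" by simp
      obtain V where V: "continuous_on {0..1} V"
        "\<forall>t\<in>{0..1}. V t \<le> v t \<and> v t \<le> V t + inverse (real (Suc n))"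
        using length_function_approx[OF cont fin pos] unfolding v_def by blast
      have "\<bar>v t - V t\<bar> \<le> inverse (real (Suc n))" if "t \<in> {0..1}" for t
        using V(2) that by force
      then show ?thesis using V(1) by blast
    qed
    then obtain V where V: "\<And>n. ?P n (V n)" using choice[of ?P] by blast
    have "uniform_limit {0..1} V v sequentially"
    proof (rule uniform_limitI)
      fix e :: real assume "e > 0"
      then obtain N where N: "inverse (real (Suc N)) < e" using reals_Archimedean by blast
      show "\<forall>\<^sub>F n in sequentially. \<forall>x\<in>{0..1}. dist (V n x) (v x) < e"
      proof (rule eventually_sequentiallyI[of N], rule ballI)
        fix n x assume "N \<le> n" and x: "x \<in> {0..1::real}"
        then have "inverse (real (Suc n)) \<le> inverse (real (Suc N))" by simp
        moreover have "\<bar>v x - V n x\<bar> \<le> inverse (real (Suc n))" using V[of n] x by blast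
        ultimately show "dist (V n x) (v x) < e" using N unfolding dist_real_def by linarith
      qed
    qed
    then show ?thesis by (rule uniform_limit_theorem[rotated]) (use V in simp_all)
  qed
  show "v 0 = 0" by (simp add: v_def curve_length_point)
qed

text \<open>
  By continuity the length function takes every value up to the total length, so the choice in the
  definition of the arclength parametrization is never made from an empty set.
\<close>

lemma arclength_param:
  fixes \<gamma> :: "real \<Rightarrow> 'a::metric_space"
  assumes cont: "continuous_on {0..1} \<gamma>" and fin: "curve_length dist \<gamma> 0 1 < \<infinity>"
  shows lipschitz_on_arclength_param:
      "1-lipschitz_on {0..enn2real (curve_length dist \<gamma> 0 1)} (arclength_param dist \<gamma>)"
    and arclength_param_length: "\<And>t. t \<in> {0..1} \<Longrightarrow>
      arclength_param dist \<gamma> (enn2real (curve_length dist \<gamma> 0 t)) = \<gamma> t"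
proof -
  define v where "v t = enn2real (curve_length dist \<gamma> 0 t)" for t
  note L = length_function[OF cont fin, folded v_def]
  define T where "T s = (SOME t. t \<in> {0..1} \<and> curve_length dist \<gamma> 0 t = ennreal s)" for s
  have v_nn: "0 \<le> v t" for t by (simp add: v_def)
  have T: "T s \<in> {0..1}" "v (T s) = s" if s: "s \<in> {0..v 1}" for s
  proof -
    have "\<exists>t\<ge>0. t \<le> 1 \<and> v t = s"
      using IVT'[of v 0 s 1] s L(4,5) by auto
    then have "\<exists>t. t \<in> {0..1} \<and> curve_length dist \<gamma> 0 t = ennreal s" using L(1) by auto
    then have "T s \<in> {0..1} \<and> curve_length dist \<gamma> 0 (T s) = ennreal s"
      unfolding T_def by (rule someI_ex)
    then show "T s \<in> {0..1}" "v (T s) = s" using s by (auto simp: v_def)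
  qed
  have d: "dist (\<gamma> s) (\<gamma> t) \<le> \<bar>v s - v t\<bar>" if "s \<in> {0..1}" "t \<in> {0..1}" for s t
    using L(2)[of s t] L(2)[of t s] that by (cases "s \<le> t") (auto simp: dist_commute)
  have a: "arclength_param dist \<gamma> s = \<gamma> (T s)" for s
    by (simp add: arclength_param_def T_def)
  show "1-lipschitz_on {0..enn2real (curve_length dist \<gamma> 0 1)} (arclength_param dist \<gamma>)"
  proof (rule lipschitz_onI)
    fix x y assume "x \<in> {0..enn2real (curve_length dist \<gamma> 0 1)}"
      "y \<in> {0..enn2real (curve_length dist \<gamma> 0 1)}"
    then show "dist (arclength_param dist \<gamma> x) (arclength_param dist \<gamma> y) \<le> 1 * dist x y"
      unfolding a using d[of "T x" "T y"] T[of x] T[of y] by (simp add: v_def dist_real_def)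
  qed simp
  show "arclength_param dist \<gamma> (enn2real (curve_length dist \<gamma> 0 t)) = \<gamma> t" if t: "t \<in> {0..1}" for t
  proof -
    have "v t \<in> {0..v 1}" using L(2)[of t 1] t v_nn[of t] zero_le_dist[of "\<gamma> t" "\<gamma> 1"]
      by (auto simp del: zero_le_dist)
    then show ?thesis using d[of "T (v t)" t] T[of "v t"] t unfolding a v_def[symmetric] by simp
  qed
qed

section \<open>The conformal distance as an infimum over Lipschitz curves\<close>

lemma integral_reparametrize_le_small:
  fixes f m :: "real \<Rightarrow> real"
  assumes f: "continuous_on {m u..m u'} f" "\<And>s. s \<in> {m u..m u'} \<Longrightarrow> 0 \<le> f s"
    and osc: "\<And>s s'. s \<in> {m u..m u'} \<Longrightarrow> s' \<in> {m u..m u'} \<Longrightarrow> \<bar>f s - f s'\<bar> \<le> \<eta>"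
    and "0 \<le> \<eta>"
    and m: "\<And>s t. u \<le> s \<Longrightarrow> s \<le> t \<Longrightarrow> t \<le> u' \<Longrightarrow> m s \<le> m t"
    and "u \<le> u'" "m u' - m u \<le> u' - u"
    and "continuous_on {u..u'} m"
  shows "integral {m u..m u'} f \<le> integral {u..u'} (\<lambda>w. f (m w)) + 2 * \<eta> * (u' - u)"
proof -
  have mm: "m u \<le> m u'" using m \<open>u \<le> u'\<close> by simp
  have "integral {m u..m u'} f \<le> integral {m u..m u'} (\<lambda>_. f (m u) + \<eta>)"
  proof (rule integral_le)
    fix s assume "s \<in> {m u..m u'}"
    then show "f s \<le> f (m u) + \<eta>" using osc[of s "m u"] mm by auto
  qed (use f in \<open>auto intro: integrable_continuous_real\<close>)
  also have "\<dots> = (f (m u) + \<eta>) * (m u' - m u)" using mm by simp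
  also have "\<dots> \<le> (f (m u) + \<eta>) * (u' - u)"
    using assms(7) f(2)[of "m u"] mm \<open>0 \<le> \<eta>\<close> by (intro mult_left_mono) auto
  also have "\<dots> = (f (m u) - \<eta>) * (u' - u) + 2 * \<eta> * (u' - u)" by (simp add: algebra_simps)
  also have "(f (m u) - \<eta>) * (u' - u) = integral {u..u'} (\<lambda>_. f (m u) - \<eta>)"
    using \<open>u \<le> u'\<close> by simp
  also have "\<dots> \<le> integral {u..u'} (\<lambda>w. f (m w))"
  proof (rule integral_le)
    show "(\<lambda>w. f (m w)) integrable_on {u..u'}"
      by (intro integrable_continuous_real continuous_on_compose2[OF f(1) assms(8)]) (use m in auto)
    fix w assume "w \<in> {u..u'}"
    then show "f (m u) - \<eta> \<le> f (m w)" using osc[of "m w" "m u"] m[of u w] m[of w u'] mm by auto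
  qed auto
  finally show ?thesis by simp
qed

text \<open>
  A change of variables inequality without any differentiability: on short intervals \<open>f\<close> is nearly
  constant, and there the claim is \<open>m u' - m u \<le> u' - u\<close>.
\<close>

lemma integral_reparametrize_le:
  fixes f m :: "real \<Rightarrow> real"
  assumes f: "continuous_on {0..m L} f" "\<And>s. s \<in> {0..m L} \<Longrightarrow> 0 \<le> f s"
    and m: "\<And>s t. 0 \<le> s \<Longrightarrow> s \<le> t \<Longrightarrow> t \<le> L \<Longrightarrow> m s \<le> m t \<and> m t - m s \<le> t - s"
    and "m 0 = 0" "0 \<le> L"
  shows "integral {0..m L} f \<le> integral {0..L} (\<lambda>w. f (m w))"
proof (rule field_le_epsilon)
  fix e :: real assume "e > 0"
  define \<eta> where "\<eta> = e / (2 * (L + 1))"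
  have "\<eta> > 0" using \<open>e > 0\<close> \<open>0 \<le> L\<close> by (simp add: \<eta>_def)
  have "uniformly_continuous_on {0..m L} f"
    using f(1) by (rule compact_uniformly_continuous) simp
  then obtain \<delta> where "\<delta> > 0"
    and \<delta>: "\<And>s s'. s \<in> {0..m L} \<Longrightarrow> s' \<in> {0..m L} \<Longrightarrow> \<bar>s - s'\<bar> < \<delta> \<Longrightarrow> \<bar>f s - f s'\<bar> < \<eta>"
    unfolding uniformly_continuous_on_def dist_real_def using \<open>\<eta> > 0\<close>
    by (metis abs_minus_commute)
  obtain n where n: "L < real n * \<delta>" using reals_Archimedean3[OF \<open>\<delta> > 0\<close>] by blast
  then have "n > 0" using \<open>0 \<le> L\<close> by (cases n) auto
  define h where "h = L / n"
  have h: "0 \<le> h" "h < \<delta>" "n * h = L"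
    using n \<open>n > 0\<close> \<open>0 \<le> L\<close> by (auto simp: h_def field_simps)
  have contm: "continuous_on {0..L} m"
  proof (rule lipschitz_on_continuous_on)
    show "1-lipschitz_on {0..L} m"
    proof (rule lipschitz_on_leI)
      fix x y :: real assume "x \<in> {0..L}" "y \<in> {0..L}" "x \<le> y"
      then show "dist (m x) (m y) \<le> 1 * dist x y" using m[of x y] by (simp add: dist_real_def)
    qed simp
  qed
  have contfm: "continuous_on {0..L} (\<lambda>w. f (m w))"
    using f(1) contm
  proof (rule continuous_on_compose2)
    show "m ` {0..L} \<subseteq> {0..m L}" using m \<open>m 0 = 0\<close> by fastforce
  qed
  have "integral {0..m (i * h)} f \<le> integral {0..i * h} (\<lambda>w. f (m w)) + 2 * \<eta> * (i * h)"
    if "i \<le> n" for i :: nat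
    using that
  proof (induction i)
    case 0
    then show ?case using \<open>m 0 = 0\<close> by simp
  next
    case (Suc i)
    define u u' where "u = i * h" and "u' = Suc i * h"
    have u: "0 \<le> u" "u \<le> u'" "u' - u = h" using h by (auto simp: u_def u'_def algebra_simps)
    have "u' \<le> n * h" unfolding u'_def using Suc.prems h(1) by (intro mult_right_mono) auto
    then have "u' \<le> L" using h by simp
    have mu: "0 \<le> m u" "m u \<le> m u'" "m u' \<le> m L" "m u' - m u \<le> h"
      using m[of 0 u] m[of u u'] m[of u' L] u \<open>u' \<le> L\<close> \<open>m 0 = 0\<close> by auto
    have "integral {0..m u'} f = integral {0..m u} f + integral {m u..m u'} f"
      using mu by (intro Henstock_Kurzweil_Integration.integral_combine[symmetric]
        integrable_continuous_real continuous_on_subset[OF f(1)]) auto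
    moreover have "integral {0..u'} (\<lambda>w. f (m w)) = integral {0..u} (\<lambda>w. f (m w)) + integral {u..u'} (\<lambda>w. f (m w))"
      using u \<open>u' \<le> L\<close> by (intro Henstock_Kurzweil_Integration.integral_combine[symmetric]
        integrable_continuous_real continuous_on_subset[OF contfm]) auto
    moreover have "integral {m u..m u'} f \<le> integral {u..u'} (\<lambda>w. f (m w)) + 2 * \<eta> * (u' - u)"
    proof (rule integral_reparametrize_le_small)
      show "\<bar>f s - f s'\<bar> \<le> \<eta>" if "s \<in> {m u..m u'}" "s' \<in> {m u..m u'}" for s s'
        using \<delta>[of s s'] that mu h(2) by force
      show "continuous_on {m u..m u'} f" by (rule continuous_on_subset[OF f(1)]) (use mu in auto)
      show "0 \<le> f s" if "s \<in> {m u..m u'}" for s using that mu by (intro f(2)) auto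
      show "continuous_on {u..u'} m" by (rule continuous_on_subset[OF contm]) (use u \<open>u' \<le> L\<close> in auto)
    qed (use mu m u \<open>u' \<le> L\<close> \<open>\<eta> > 0\<close> in auto)
    moreover have "integral {0..m u} f \<le> integral {0..u} (\<lambda>w. f (m w)) + 2 * \<eta> * u"
      using Suc by (simp add: u_def)
    moreover have "2 * \<eta> * u' = 2 * \<eta> * u + 2 * \<eta> * (u' - u)" by (simp add: algebra_simps)
    ultimately show ?case unfolding u_def u'_def by linarith
  qed
  from this[of n] have "integral {0..m L} f \<le> integral {0..L} (\<lambda>w. f (m w)) + 2 * \<eta> * L"
    using h by simp
  also have "2 * \<eta> * L \<le> e" using \<open>e > 0\<close> \<open>0 \<le> L\<close> by (simp add: \<eta>_def field_simps)
  finally show "integral {0..m L} f \<le> integral {0..L} (\<lambda>w. f (m w)) + e" by simp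
qed

lemma pathin_euclidean: "pathin euclidean \<gamma> \<longleftrightarrow> continuous_on {0..1} \<gamma>"
  by (simp add: pathin_def)

lemma arclength_integral_nonneg:
  assumes "\<And>x. 0 \<le> \<rho> x" shows "0 \<le> arclength_integral d \<rho> \<gamma>"
  unfolding arclength_integral_def
  by (metis Henstock_Kurzweil_Integration.integral_nonneg assms not_integrable_integral order_refl)

text \<open>
  Together with \<open>conformal_dist_greatest\<close> below, this describes the conformal distance by
  1-Lipschitz curves on intervals of arbitrary length, where concatenation, reversal and
  restriction are immediate.  A 1-Lipschitz curve may be slower than its arclength
  parametrization, and the reparametrization inequality says that slowness only adds to the integral.
\<close>

lemma conformal_dist_le_integral:
  fixes \<rho> :: "'a::metric_space \<Rightarrow> real" and g :: "real \<Rightarrow> 'a"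
  assumes \<rho>: "continuous_on UNIV \<rho>" "\<And>x. 0 \<le> \<rho> x"
    and "0 \<le> L" and g: "1-lipschitz_on {0..L} g" "g 0 = x" "g L = y"
  shows "conformal_dist \<rho> x y \<le> integral {0..L} (\<lambda>s. \<rho> (g s))"
proof -
  define \<gamma> where "\<gamma> t = g (L * t)" for t
  have rng: "L * t \<in> {0..L}" if "t \<in> {0..1}" for t
    using that \<open>0 \<le> L\<close> mult_left_mono[of t 1 L] by auto
  have len: "curve_length dist \<gamma> s t \<le> ennreal (L * (t - s))" if "0 \<le> s" "s \<le> t" "t \<le> 1" for s t
  proof -
    have "curve_length dist \<gamma> s t \<le> ennreal (L * t - L * s)"
    proof (rule curve_length_le_increment)
      fix s' t' assume "s \<le> s'" "s' \<le> t'" "t' \<le> t"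
      then have "dist (g (L * s')) (g (L * t')) \<le> 1 * dist (L * s') (L * t')" "L * s' \<le> L * t'"
        using lipschitz_onD[OF g(1) rng rng, of s' t'] that \<open>0 \<le> L\<close> by (auto intro!: mult_left_mono)
      then show "dist (\<gamma> s') (\<gamma> t') \<le> L * t' - L * s'" by (simp add: \<gamma>_def dist_real_def)
      show "L * s' \<le> L * t'" by fact
    qed
    then show ?thesis by (simp add: right_diff_distrib)
  qed
  have cont: "continuous_on {0..1} \<gamma>" unfolding \<gamma>_def
    by (intro continuous_on_compose2[OF lipschitz_on_continuous_on[OF g(1)]] continuous_intros)
      (use rng in auto)
  have fin: "curve_length dist \<gamma> 0 1 < \<infinity>"
    using len[of 0 1] by (auto intro: le_less_trans)
  have rect: "rectifiable_curve UNIV dist \<gamma> x y"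
    using cont fin g by (simp add: rectifiable_curve_def pathin_euclidean \<gamma>_def)
  define v where "v t = enn2real (curve_length dist \<gamma> 0 t)" for t
  note v = length_function[OF cont fin, folded v_def]
  have vmono: "v s \<le> v t" if "0 \<le> s" "s \<le> t" "t \<le> 1" for s t
    using v(2)[OF that] zero_le_dist[of "\<gamma> s" "\<gamma> t"] by linarith
  have lipv: "v t - v s \<le> L * (t - s)" if "0 \<le> s" "s \<le> t" "t \<le> 1" for s t
    using v(3)[of s t "L * (t - s)"] len[of s t] that \<open>0 \<le> L\<close> by simp
  have "conformal_dist \<rho> x y \<le> arclength_integral dist \<rho> \<gamma>"
    unfolding conformal_dist_def
  proof (rule cINF_lower)
    show "bdd_below (arclength_integral dist \<rho> ` {\<gamma>. rectifiable_curve UNIV dist \<gamma> x y})"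
      by (rule bdd_belowI[of _ 0]) (auto intro: arclength_integral_nonneg \<rho>)
  qed (use rect in simp)
  also have "\<dots> = integral {0..v 1} (\<lambda>s. \<rho> (arclength_param dist \<gamma> s))"
    by (simp add: arclength_integral_def v_def)
  also have "\<dots> \<le> integral {0..L} (\<lambda>s. \<rho> (g s))"
  proof (cases "L = 0")
    case True
    then have "v 1 = 0" using lipv[of 0 1] vmono[of 0 1] v(5) by simp
    then show ?thesis using True by simp
  next
    case False
    with \<open>0 \<le> L\<close> have "L > 0" by simp
    define m where "m u = v (u / L)" for u
    have contf: "continuous_on {0..m L} (\<lambda>s. \<rho> (arclength_param dist \<gamma> s))"
    proof -
      have "m L = enn2real (curve_length dist \<gamma> 0 1)" using \<open>L > 0\<close> by (simp add: m_def v_def)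
      then show ?thesis
        using continuous_on_compose2[OF \<rho>(1)
            lipschitz_on_continuous_on[OF lipschitz_on_arclength_param[OF cont fin]]] by simp
    qed
    have "integral {0..m L} (\<lambda>s. \<rho> (arclength_param dist \<gamma> s))
        \<le> integral {0..L} (\<lambda>w. \<rho> (arclength_param dist \<gamma> (m w)))"
    proof (rule integral_reparametrize_le[where m = m and L = L, OF contf])
      fix s t assume "0 \<le> s" "s \<le> t" "t \<le> L"
      then have "0 \<le> s / L" "s / L \<le> t / L" "t / L \<le> 1"
        using \<open>L > 0\<close> by (auto simp: divide_right_mono)
      then show "m s \<le> m t \<and> m t - m s \<le> t - s"
        using vmono[of "s / L" "t / L"] lipv[of "s / L" "t / L"] \<open>L > 0\<close>
        by (simp add: m_def right_diff_distrib)
    qed (use \<rho> v(5) \<open>0 \<le> L\<close> in \<open>auto simp: m_def\<close>)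
    also have "\<dots> = integral {0..L} (\<lambda>s. \<rho> (g s))"
    proof (rule Henstock_Kurzweil_Integration.integral_cong)
      fix w assume "w \<in> {0..L}"
      then have "w / L \<in> {0..1}" using \<open>L > 0\<close> by auto
      then show "\<rho> (arclength_param dist \<gamma> (m w)) = \<rho> (g w)"
        using arclength_param_length[OF cont fin, of "w / L"] \<open>L > 0\<close>
        by (simp add: m_def v_def \<gamma>_def)
    qed
    finally show ?thesis using \<open>L > 0\<close> by (simp add: m_def)
  qed
  finally show ?thesis .
qed

lemma geodesic_lipschitz:
  fixes x y :: "'a::metric_space"
  assumes "geodesic_space TYPE('a)"
  obtains g :: "real \<Rightarrow> 'a" where "1-lipschitz_on {0..dist x y} g" "g 0 = x" "g (dist x y) = y"
proof -
  obtain g :: "real \<Rightarrow> 'a" where g: "g 0 = x" "g (dist x y) = y"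
    "\<forall>s\<in>{0..dist x y}. \<forall>t\<in>{0..dist x y}. dist (g s) (g t) = \<bar>s - t\<bar>"
    using assms unfolding geodesic_space_def by blast
  then show thesis using that[of g] by (auto simp: lipschitz_on_def dist_real_def)
qed

lemma conformal_dist_greatest:
  fixes \<rho> :: "'a::metric_space \<Rightarrow> real"
  assumes geo: "geodesic_space TYPE('a)"
    and c: "\<And>L (g :: real \<Rightarrow> 'a). 0 \<le> L \<Longrightarrow> 1-lipschitz_on {0..L} g \<Longrightarrow> g 0 = x \<Longrightarrow> g L = y \<Longrightarrow>
      c \<le> integral {0..L} (\<lambda>s. \<rho> (g s))"
  shows "c \<le> conformal_dist \<rho> x y"
  unfolding conformal_dist_def
proof (rule cINF_greatest)
  obtain g :: "real \<Rightarrow> 'a" where g: "1-lipschitz_on {0..dist x y} g" "g 0 = x" "g (dist x y) = y"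
    by (rule geodesic_lipschitz[OF geo])
  define \<gamma> where "\<gamma> t = g (dist x y * t)" for t
  have rng: "dist x y * t \<in> {0..dist x y}" if "t \<in> {0..1}" for t
    using that mult_left_mono[of t 1 "dist x y"] by auto
  have "continuous_on {0..1} \<gamma>" unfolding \<gamma>_def
    by (intro continuous_on_compose2[OF lipschitz_on_continuous_on[OF g(1)]] continuous_intros)
      (use rng in auto)
  moreover have "curve_length dist \<gamma> 0 1 \<le> ennreal (dist x y * 1 - dist x y * 0)"
  proof (rule curve_length_le_increment)
    fix s t :: real assume "0 \<le> s" "s \<le> t" "t \<le> 1"
    then have "dist (g (dist x y * s)) (g (dist x y * t)) \<le> 1 * dist (dist x y * s) (dist x y * t)"
      "dist x y * s \<le> dist x y * t"
      using lipschitz_onD[OF g(1) rng rng, of s t] by (auto intro!: mult_left_mono)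
    then show "dist (\<gamma> s) (\<gamma> t) \<le> dist x y * t - dist x y * s" by (simp add: \<gamma>_def dist_real_def)
    show "dist x y * s \<le> dist x y * t" by fact
  qed
  ultimately have "rectifiable_curve UNIV dist \<gamma> x y"
    using g(2,3) by (auto simp: rectifiable_curve_def pathin_euclidean \<gamma>_def[symmetric] intro: le_less_trans)
      (simp_all add: \<gamma>_def)
  then show "{\<gamma>. rectifiable_curve UNIV dist \<gamma> x y} \<noteq> {}" by blast
  fix \<gamma> :: "real \<Rightarrow> 'a" assume "\<gamma> \<in> {\<gamma>. rectifiable_curve UNIV dist \<gamma> x y}"
  then have \<gamma>: "continuous_on {0..1} \<gamma>" "curve_length dist \<gamma> 0 1 < \<infinity>" "\<gamma> 0 = x" "\<gamma> 1 = y"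
    by (auto simp: rectifiable_curve_def pathin_euclidean)
  show "c \<le> arclength_integral dist \<rho> \<gamma>"
    unfolding arclength_integral_def
    using arclength_param_length[OF \<gamma>(1,2), of 0] arclength_param_length[OF \<gamma>(1,2), of 1]
      lipschitz_on_arclength_param[OF \<gamma>(1,2)] \<gamma>(3,4)
    by (intro c) (simp_all add: curve_length_point)
qed

section \<open>Conformal deformations by Harnack densities\<close>

lemma lipschitz_on_shift:
  fixes g :: "real \<Rightarrow> 'a::metric_space"
  assumes "C-lipschitz_on {a..b} g" "a = a' + c" "b = b' + c"
  shows "C-lipschitz_on {a'..b'} (\<lambda>s. g (s + c))"
proof (rule lipschitz_onI)
  fix s t assume "s \<in> {a'..b'}" "t \<in> {a'..b'}"
  then show "dist (g (s + c)) (g (t + c)) \<le> C * dist s t"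
    using lipschitz_onD[OF assms(1), of "s + c" "t + c"] assms(2,3) by (simp add: dist_real_def)
qed (rule lipschitz_on_nonneg[OF assms(1)])

text \<open>
  The common properties of \<open>exp (- \<epsilon> * b)\<close> on both spaces; for a 2-Lipschitz \<open>b\<close> one has
  \<open>k = 2 * \<epsilon>\<close>.
\<close>

locale harnack_density =
  fixes \<rho> :: "'a::metric_space \<Rightarrow> real" and k :: real
  assumes proper: "proper_space TYPE('a)"
    and geodesic: "geodesic_space TYPE('a)"
    and pos: "\<And>x. 0 < \<rho> x"
    and k_nonneg: "0 \<le> k"
    and harnack: "\<And>x y. \<rho> x \<le> exp (k * dist x y) * \<rho> y"
begin

abbreviation d where "d \<equiv> conformal_dist \<rho>"

lemma nonneg: "0 \<le> \<rho> x" using pos less_imp_le by blast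

lemma harnack_le: "dist x y \<le> r \<Longrightarrow> \<rho> x \<le> exp (k * r) * \<rho> y"
  using harnack[of x y] k_nonneg nonneg[of y]
  by (meson exp_le_cancel_iff mult_left_mono mult_right_mono order_trans)

lemma harnack_ge: "dist x y \<le> r \<Longrightarrow> exp (- k * r) * \<rho> x \<le> \<rho> y"
  using harnack_le[of x y r] by (simp add: exp_minus field_simps)

lemma continuous: "continuous_on S \<rho>"
proof -
  have "isCont \<rho> x" for x
    unfolding isCont_def
  proof (rule tendsto_sandwich)
    have "((\<lambda>y. exp (- k * dist x y) * \<rho> x) \<longlongrightarrow> exp (- k * dist x x) * \<rho> x) (at x)"
      by (intro tendsto_intros)
    then show "((\<lambda>y. exp (- k * dist x y) * \<rho> x) \<longlongrightarrow> \<rho> x) (at x)" by simp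
    have "((\<lambda>y. exp (k * dist y x) * \<rho> x) \<longlongrightarrow> exp (k * dist x x) * \<rho> x) (at x)"
      by (intro tendsto_intros)
    then show "((\<lambda>y. exp (k * dist y x) * \<rho> x) \<longlongrightarrow> \<rho> x) (at x)" by simp
  qed (use harnack harnack_ge[OF order_refl] in auto)
  then show ?thesis by (simp add: continuous_at_imp_continuous_on)
qed

lemma integrable_along:
  fixes g :: "real \<Rightarrow> 'a"
  assumes "1-lipschitz_on {a..b} g" shows "(\<lambda>s. \<rho> (g s)) integrable_on {a..b}"
  by (intro integrable_continuous_real continuous_on_compose2[OF continuous[of UNIV]]
      lipschitz_on_continuous_on[OF assms]) auto

lemma integral_along_nonneg:
  fixes g :: "real \<Rightarrow> 'a"
  shows "1-lipschitz_on {a..b} g \<Longrightarrow> 0 \<le> integral {a..b} (\<lambda>s. \<rho> (g s))"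
  by (intro Henstock_Kurzweil_Integration.integral_nonneg integrable_along nonneg)

lemma integral_along_combine:
  fixes g :: "real \<Rightarrow> 'a"
  assumes "1-lipschitz_on {a..c} g" "a \<le> b" "b \<le> c"
  shows "integral {a..b} (\<lambda>s. \<rho> (g s)) + integral {b..c} (\<lambda>s. \<rho> (g s)) = integral {a..c} (\<lambda>s. \<rho> (g s))"
  by (intro Henstock_Kurzweil_Integration.integral_combine integrable_along assms)

lemma integral_along_mono:
  fixes g :: "real \<Rightarrow> 'a"
  assumes "1-lipschitz_on {a..e} g" "a \<le> b" "b \<le> c" "c \<le> e"
  shows "integral {b..c} (\<lambda>s. \<rho> (g s)) \<le> integral {a..e} (\<lambda>s. \<rho> (g s))"
  by (intro integral_subset_le integrable_along lipschitz_on_subset[OF assms(1)]) (use assms nonneg in auto)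

lemma integral_along_le:
  fixes g :: "real \<Rightarrow> 'a"
  assumes g: "1-lipschitz_on {a..b} g" and "a \<le> b" "\<And>s. s \<in> {a..b} \<Longrightarrow> dist (g s) x \<le> r"
  shows "integral {a..b} (\<lambda>s. \<rho> (g s)) \<le> exp (k * r) * \<rho> x * (b - a)"
proof -
  have "integral {a..b} (\<lambda>s. \<rho> (g s)) \<le> integral {a..b} (\<lambda>s. exp (k * r) * \<rho> x)"
    by (intro integral_le integrable_along[OF g] harnack_le assms) auto
  then show ?thesis using \<open>a \<le> b\<close> by (simp add: mult_ac)
qed

lemma integral_along_ge:
  fixes g :: "real \<Rightarrow> 'a"
  assumes g: "1-lipschitz_on {a..b} g" and "a \<le> b" "\<And>s. s \<in> {a..b} \<Longrightarrow> dist x (g s) \<le> r"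
  shows "exp (- k * r) * \<rho> x * (b - a) \<le> integral {a..b} (\<lambda>s. \<rho> (g s))"
proof -
  have "integral {a..b} (\<lambda>s. exp (- k * r) * \<rho> x) \<le> integral {a..b} (\<lambda>s. \<rho> (g s))"
    by (intro integral_le integrable_along[OF g] harnack_ge assms) auto
  then show ?thesis using \<open>a \<le> b\<close> by (simp add: mult_ac)
qed

lemma d_le_integral:
  fixes g :: "real \<Rightarrow> 'a"
  assumes g: "1-lipschitz_on {a..b} g" and "a \<le> b"
  shows "d (g a) (g b) \<le> integral {a..b} (\<lambda>s. \<rho> (g s))"
proof -
  have "d (g a) (g b) \<le> integral {0..b - a} (\<lambda>s. \<rho> (g (a + s)))"
  proof (rule conformal_dist_le_integral)
    show "1-lipschitz_on {0..b - a} (\<lambda>s. g (a + s))"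
      using lipschitz_on_shift[OF g, of 0 a "b - a"] by (simp add: add.commute)
  qed (use \<open>a \<le> b\<close> continuous nonneg in auto)
  also have "\<dots> = integral {a..b} (\<lambda>s. \<rho> (g s))"
    using integral_shift_Icc_real[of 0 "b - a" "\<lambda>s. \<rho> (g s)" a] by (simp add: o_def)
  finally show ?thesis .
qed

lemmas d_greatest = conformal_dist_greatest[OF geodesic]

lemma d_nonneg: "0 \<le> d x y"
  by (rule d_greatest) (rule integral_along_nonneg)

text \<open>
  A curve from \<open>x\<close> to \<open>y\<close> stays in the unit ball around \<open>x\<close> for a time at least \<open>min 1 (dist x y)\<close>,
  and \<open>\<rho>\<close> is at least \<open>exp (- k) * \<rho> x\<close> there.
\<close>

lemma d_ge: "exp (- k) * \<rho> x * min 1 (dist x y) \<le> d x y"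
proof (rule d_greatest)
  fix L and g :: "real \<Rightarrow> 'a"
  assume g: "0 \<le> L" "1-lipschitz_on {0..L} g" "g 0 = x" "g L = y"
  define m where "m = min 1 (dist x y)"
  have "dist x y \<le> L" using lipschitz_onD[OF g(2), of 0 L] g by (simp add: dist_real_def)
  then have m: "0 \<le> m" "m \<le> 1" "m \<le> L" by (auto simp: m_def)
  have "exp (- k * 1) * \<rho> x * (m - 0) \<le> integral {0..m} (\<lambda>s. \<rho> (g s))"
  proof (rule integral_along_ge)
    show "1-lipschitz_on {0..m} g" using g(2) by (rule lipschitz_on_subset) (use m in auto)
    show "dist x (g s) \<le> 1" if "s \<in> {0..m}" for s
      using lipschitz_onD[OF g(2), of 0 s] that m g by (auto simp: dist_real_def)
  qed (use m in auto)
  also have "\<dots> \<le> integral {0..L} (\<lambda>s. \<rho> (g s))"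
    by (rule integral_along_mono[OF g(2)]) (use m in auto)
  finally show "exp (- k) * \<rho> x * min 1 (dist x y) \<le> integral {0..L} (\<lambda>s. \<rho> (g s))"
    by (simp add: m_def)
qed

lemma d_le: "d x y \<le> exp (k * dist x y) * \<rho> x * dist x y"
proof -
  obtain g where g: "1-lipschitz_on {0..dist x y} g" "g 0 = x" "g (dist x y) = y"
    by (rule geodesic_lipschitz[OF geodesic])
  have "d x y \<le> integral {0..dist x y} (\<lambda>s. \<rho> (g s))" using d_le_integral[OF g(1)] g by simp
  also have "\<dots> \<le> exp (k * dist x y) * \<rho> x * (dist x y - 0)"
  proof (rule integral_along_le[OF g(1)])
    show "dist (g s) x \<le> dist x y" if "s \<in> {0..dist x y}" for s
      using lipschitz_onD[OF g(1), of s 0] that g(2) by (auto simp: dist_real_def)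
  qed simp
  finally show ?thesis by simp
qed

lemma d_le': "dist x y \<le> r \<Longrightarrow> d x y \<le> exp (k * r) * r * \<rho> x"
proof -
  assume r: "dist x y \<le> r"
  have "exp (k * dist x y) * \<rho> x * dist x y \<le> exp (k * r) * \<rho> x * r"
    using r k_nonneg nonneg[of x]
    by (intro mult_mono) (auto intro: mult_left_mono)
  then show ?thesis using d_le[of x y] by (simp add: mult_ac)
qed

lemma d_commute_le: "d x y \<le> d y x"
proof (rule d_greatest)
  fix L and g :: "real \<Rightarrow> 'a"
  assume g: "0 \<le> L" "1-lipschitz_on {0..L} g" "g 0 = y" "g L = x"
  define h where "h s = g (- s)" for s
  have "1-lipschitz_on {-L..-0} h"
  proof (rule lipschitz_onI)
    fix s t assume "s \<in> {-L..-0}" "t \<in> {-L..-0}"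
    then show "dist (h s) (h t) \<le> 1 * dist s t"
      using lipschitz_onD[OF g(2), of "- s" "- t"] by (auto simp: h_def dist_real_def)
  qed simp
  then have "d x y \<le> integral {-L..-0} (\<lambda>s. \<rho> (h s))"
    using d_le_integral[of "-L" "-0" h] g by (simp add: h_def)
  also have "\<dots> = integral {0..L} (\<lambda>s. \<rho> (g s))"
    unfolding h_def
    using Henstock_Kurzweil_Integration.integral_reflect_real[of L 0 "\<lambda>s. \<rho> (g s)"] by simp
  finally show "d x y \<le> integral {0..L} (\<lambda>s. \<rho> (g s))" .
qed

lemma d_triangle: "d x z \<le> d x y + d y z"
proof -
  have "d x z - d x y \<le> d y z"
  proof (rule d_greatest)
    fix M and h :: "real \<Rightarrow> 'a"
    assume h: "0 \<le> M" "1-lipschitz_on {0..M} h" "h 0 = y" "h M = z"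
    have "d x z - integral {0..M} (\<lambda>s. \<rho> (h s)) \<le> d x y"
    proof (rule d_greatest)
      fix L and g :: "real \<Rightarrow> 'a"
      assume g: "0 \<le> L" "1-lipschitz_on {0..L} g" "g 0 = x" "g L = y"
      define j where "j s = (if s \<le> L then g s else h (s - L))" for s
      have "1-lipschitz_on {0..L + M} j"
        unfolding j_def
      proof (rule lipschitz_on_concat[OF g(2)])
        show "1-lipschitz_on {L..L + M} (\<lambda>x. h (x - L))"
          using lipschitz_on_shift[OF h(2), of L "- L" "L + M"] by simp
      qed (use g h in auto)
      from d_le_integral[OF this] integral_along_combine[OF this, of L] g(1) h(1)
      have "d (j 0) (j (L + M)) \<le> integral {0..L} (\<lambda>s. \<rho> (j s)) + integral {L..L + M} (\<lambda>s. \<rho> (j s))"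
        by simp
      also have "integral {0..L} (\<lambda>s. \<rho> (j s)) = integral {0..L} (\<lambda>s. \<rho> (g s))"
        by (rule Henstock_Kurzweil_Integration.integral_cong) (auto simp: j_def)
      also have "integral {L..L + M} (\<lambda>s. \<rho> (j s)) = integral {L..L + M} (\<lambda>s. \<rho> (h (s - L)))"
        by (rule Henstock_Kurzweil_Integration.integral_cong) (use g h in \<open>auto simp: j_def\<close>)
      also have "\<dots> = integral {0..M} (\<lambda>s. \<rho> (h s))"
        using integral_shift_Icc_real[of 0 M "\<lambda>s. \<rho> (h (s - L))" L] by (simp add: o_def add.commute)
      finally have "d (j 0) (j (L + M)) \<le> integral {0..L} (\<lambda>s. \<rho> (g s)) + integral {0..M} (\<lambda>s. \<rho> (h s))" .
      moreover have "j 0 = x" "j (L + M) = z" using g h by (auto simp: j_def)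
      ultimately show "d x z - integral {0..M} (\<lambda>s. \<rho> (h s)) \<le> integral {0..L} (\<lambda>s. \<rho> (g s))" by simp
    qed
    then show "d x z - d x y \<le> integral {0..M} (\<lambda>s. \<rho> (h s))" by linarith
  qed
  then show ?thesis by linarith
qed

lemma d_eq_0_iff: "d x y = 0 \<longleftrightarrow> x = y"
proof
  assume "d x y = 0"
  show "x = y"
  proof (rule ccontr)
    assume "x \<noteq> y"
    then have "0 < exp (- k) * \<rho> x * min 1 (dist x y)" using pos[of x] by simp
    then show False using d_ge[of x y] \<open>d x y = 0\<close> by simp
  qed
qed (use d_le[of x y] d_nonneg[of x y] in simp)

sublocale M: Metric_space UNIV d
  by standard (use d_nonneg d_commute_le d_eq_0_iff d_triangle in \<open>auto intro: antisym\<close>)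

lemma dist_less_if_d_less:
  assumes "0 < e" "e \<le> 1" "d x y < exp (- k) * \<rho> x * e" shows "dist x y < e"
proof -
  have "exp (- k) * \<rho> x * min 1 (dist x y) < exp (- k) * \<rho> x * e" using d_ge[of x y] assms(3) by linarith
  then show ?thesis using assms(2) pos[of x] by (simp add: min_def split: if_splits)
qed

lemma d_small:
  assumes "0 < e" obtains r where "0 < r" "\<And>y. dist x y < r \<Longrightarrow> d x y < e"
proof
  define r where "r = min 1 (e / (2 * exp k * \<rho> x))"
  have P: "0 < exp k * \<rho> x" using pos[of x] by simp
  show "0 < r" using assms P by (simp add: r_def)
  fix y assume y: "dist x y < r"
  have "d x y \<le> exp (k * dist x y) * \<rho> x * dist x y" by (rule d_le)
  also have "\<dots> \<le> exp (k * 1) * \<rho> x * (e / (2 * exp k * \<rho> x))"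
    using y k_nonneg nonneg[of x] P assms
    by (intro mult_mono) (auto simp: r_def mult_left_le)
  also have "\<dots> < e" using P assms by (simp add: field_simps)
  finally show "d x y < e" .
qed

text \<open>The metrics \<open>d\<close> and \<open>dist\<close> are locally comparable, by \<open>d_ge\<close> and \<open>d_le\<close>.\<close>

lemma mtopology_eq: "M.mtopology = euclidean"
proof (rule topology_eq[THEN iffD2], intro allI)
  fix U :: "'a set"
  have "(\<exists>r>0. M.mball x r \<subseteq> U) \<longleftrightarrow> (\<exists>e>0. ball x e \<subseteq> U)" for x
  proof
    assume "\<exists>r>0. M.mball x r \<subseteq> U"
    then obtain r where r: "0 < r" "M.mball x r \<subseteq> U" by blast
    obtain s where s: "0 < s" "\<And>y. dist x y < s \<Longrightarrow> d x y < r" using d_small[OF r(1)] by blast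
    then have "ball x s \<subseteq> U" using r by force
    then show "\<exists>e>0. ball x e \<subseteq> U" using s by blast
  next
    assume "\<exists>e>0. ball x e \<subseteq> U"
    then obtain e where e: "0 < e" "ball x e \<subseteq> U" by blast
    define e' where "e' = min 1 e"
    have "M.mball x (exp (- k) * \<rho> x * e') \<subseteq> ball x e'"
      using dist_less_if_d_less[of e' x] e(1) by (auto simp: e'_def)
    moreover have "0 < exp (- k) * \<rho> x * e'" using pos[of x] e(1) by (simp add: e'_def)
    moreover have "ball x e' \<subseteq> ball x e" by (auto simp: e'_def)
    ultimately show "\<exists>r>0. M.mball x r \<subseteq> U" using e(2) by blast
  qed
  then show "openin M.mtopology U \<longleftrightarrow> openin euclidean U"
    by (simp add: M.openin_mtopology open_contains_ball Ball_def)
qed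

lemma locally_compact: "locally_compact_space M.mtopology"
  unfolding mtopology_eq locally_compact_space_def
proof
  fix x :: 'a
  show "\<exists>U K. openin euclidean U \<and> compactin euclidean K \<and> x \<in> U \<and> U \<subseteq> K"
    using proper unfolding proper_space_def
    by (intro exI[of _ "ball x 1"] exI[of _ "cball x 1"]) auto
qed

end

section \<open>Metric boundaries\<close>

context Metric_space
begin

lemma cauchy_rel_refl: "MCauchy u \<Longrightarrow> u \<in> cauchy_rel M d `` {u}"
  by (auto simp: cauchy_rel_def MCauchy_def range_subsetD)

lemma dist_diff_le:
  assumes "x \<in> M" "y \<in> M" "x' \<in> M" "y' \<in> M"
  shows "\<bar>d x y - d x' y'\<bar> \<le> d x x' + d y y'"
  using triangle[of x x' y] triangle[of x' y' y] triangle[of x' x y'] triangle[of x y y']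
    commute[of x x'] commute[of y y'] assms by auto

lemma completion_dist_tendsto:
  assumes u: "MCauchy u" and v: "MCauchy v"
  shows "(\<lambda>n. d (u n) (v n)) \<longlonglongrightarrow> completion_dist d (cauchy_rel M d `` {u}) (cauchy_rel M d `` {v})"
proof -
  have uM: "u n \<in> M" and vM: "v n \<in> M" for n using u v by (auto simp: MCauchy_def)
  have "Cauchy (\<lambda>n. d (u n) (v n))"
  proof (rule metric_CauchyI)
    fix e :: real assume "e > 0"
    then obtain N1 N2 where N: "\<And>n n'. N1 \<le> n \<Longrightarrow> N1 \<le> n' \<Longrightarrow> d (u n) (u n') < e / 2"
      "\<And>n n'. N2 \<le> n \<Longrightarrow> N2 \<le> n' \<Longrightarrow> d (v n) (v n') < e / 2"
      using u v unfolding MCauchy_def by (meson half_gt_zero)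
    have "dist (d (u m) (v m)) (d (u n) (v n)) < e" if "max N1 N2 \<le> m" "max N1 N2 \<le> n" for m n
      using dist_diff_le[OF uM[of m] vM[of m] uM[of n] vM[of n]] N(1)[of m n] N(2)[of m n] that
      by (simp add: dist_real_def)
    then show "\<exists>N. \<forall>m\<ge>N. \<forall>n\<ge>N. dist (d (u m) (v m)) (d (u n) (v n)) < e" by blast
  qed
  then obtain r where r: "(\<lambda>n. d (u n) (v n)) \<longlonglongrightarrow> r"
    by (auto simp: Cauchy_convergent_iff convergent_def)
  have lim: "(\<lambda>n. d (u' n) (v' n)) \<longlonglongrightarrow> r"
    if "u' \<in> cauchy_rel M d `` {u}" "v' \<in> cauchy_rel M d `` {v}" for u' v'
  proof -
    from that have "MCauchy u'" "MCauchy v'" and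
      l: "(\<lambda>n. d (u n) (u' n)) \<longlonglongrightarrow> 0" "(\<lambda>n. d (v n) (v' n)) \<longlonglongrightarrow> 0"
      by (auto simp: cauchy_rel_def)
    then have M': "u' n \<in> M" "v' n \<in> M" for n by (auto simp: MCauchy_def)
    have "(\<lambda>n. d (u n) (v n) - d (u' n) (v' n)) \<longlonglongrightarrow> 0"
    proof (rule Lim_null_comparison)
      show "(\<lambda>n. d (u n) (u' n) + d (v n) (v' n)) \<longlonglongrightarrow> 0" using tendsto_add[OF l] by simp
      show "\<forall>\<^sub>F n in sequentially. norm (d (u n) (v n) - d (u' n) (v' n)) \<le> d (u n) (u' n) + d (v n) (v' n)"
        using dist_diff_le[OF uM vM M'] by simp
    qed
    from tendsto_diff[OF r this] show ?thesis by simp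
  qed
  have "completion_dist d (cauchy_rel M d `` {u}) (cauchy_rel M d `` {v}) = r"
    unfolding completion_dist_def
  proof (rule the_equality)
    show "\<forall>u'\<in>cauchy_rel M d `` {u}. \<forall>v'\<in>cauchy_rel M d `` {v}. (\<lambda>n. d (u' n) (v' n)) \<longlonglongrightarrow> r"
      using lim by blast
    fix r' assume "\<forall>u'\<in>cauchy_rel M d `` {u}. \<forall>v'\<in>cauchy_rel M d `` {v}. (\<lambda>n. d (u' n) (v' n)) \<longlonglongrightarrow> r'"
    then have "(\<lambda>n. d (u n) (v n)) \<longlonglongrightarrow> r'" using cauchy_rel_refl u v by blast
    then show "r' = r" using r LIMSEQ_unique by blast
  qed
  then show ?thesis using r by simp
qed

text \<open>
  Boundary points become sequences in the space itself, along which distances to the boundary can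
  be estimated.
\<close>

lemma metric_boundary_iff:
  "P \<in> metric_boundary M d \<longleftrightarrow>
    (\<exists>u. MCauchy u \<and> P = cauchy_rel M d `` {u} \<and> (\<nexists>a. limitin mtopology u a sequentially))"
proof -
  have "cauchy_rel M d `` {u} \<in> completion_embed M d ` M \<longleftrightarrow> (\<exists>a. limitin mtopology u a sequentially)"
    if u: "MCauchy u" for u
  proof
    assume "cauchy_rel M d `` {u} \<in> completion_embed M d ` M"
    then obtain z where "z \<in> M" "u \<in> cauchy_rel M d `` {\<lambda>n. z}"
      using cauchy_rel_refl[OF u] by (auto simp: completion_embed_def)
    then have "limitin mtopology u z sequentially"
      using u by (auto simp: cauchy_rel_def limitin_metric_dist_null commute MCauchy_def range_subsetD)
    then show "\<exists>a. limitin mtopology u a sequentially" by blast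
  next
    assume "\<exists>a. limitin mtopology u a sequentially"
    then obtain a where a: "a \<in> M" "(\<lambda>n. d (u n) a) \<longlonglongrightarrow> 0"
      by (auto simp: limitin_metric_dist_null)
    have uM: "u n \<in> M" for n using u by (auto simp: MCauchy_def)
    have "(\<lambda>n. d (u n) (w n)) \<longlonglongrightarrow> 0 \<longleftrightarrow> (\<lambda>n. d a (w n)) \<longlonglongrightarrow> 0" if w: "MCauchy w" for w
    proof -
      have wM: "w n \<in> M" for n using w by (auto simp: MCauchy_def)
      have "(\<lambda>n. d (u n) (w n) - d a (w n)) \<longlonglongrightarrow> 0"
      proof (rule Lim_null_comparison[OF _ a(2)])
        have "\<bar>d (u n) (w n) - d a (w n)\<bar> \<le> d (u n) a" for n
          using dist_diff_le[OF uM[of n] wM[of n] a(1) wM[of n]] wM[of n] by simp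
        then show "\<forall>\<^sub>F n in sequentially. norm (d (u n) (w n) - d a (w n)) \<le> d (u n) a" by simp
      qed
      from tendsto_diff[OF _ this] tendsto_add[OF _ this] show ?thesis by fastforce
    qed
    then have "cauchy_rel M d `` {u} = cauchy_rel M d `` {\<lambda>n. a}"
      using u a(1) by (auto simp: cauchy_rel_def)
    then show "cauchy_rel M d `` {u} \<in> completion_embed M d ` M"
      using a(1) by (auto simp: completion_embed_def)
  qed
  then show ?thesis
    unfolding metric_boundary_def completion_def quotient_def by auto
qed

lemma completion_embed_dist_tendsto:
  assumes "z \<in> M" "MCauchy u"
  shows "(\<lambda>n. d z (u n)) \<longlonglongrightarrow> completion_dist d (completion_embed M d z) (cauchy_rel M d `` {u})"
  using completion_dist_tendsto[of "\<lambda>n. z" u] assms by (simp add: completion_embed_def)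

lemma dist_to_boundary_le:
  assumes "z \<in> M" "MCauchy u" "\<nexists>a. limitin mtopology u a sequentially"
    and "\<And>n. d z (u n) \<le> B"
  shows "dist_to_boundary M d z \<le> B"
proof -
  have "dist_to_boundary M d z \<le> completion_dist d (completion_embed M d z) (cauchy_rel M d `` {u})"
    unfolding dist_to_boundary_def
  proof (rule cINF_lower)
    show "bdd_below (completion_dist d (completion_embed M d z) ` metric_boundary M d)"
    proof (rule bdd_belowI2)
      fix P assume "P \<in> metric_boundary M d"
      then obtain v where "MCauchy v" "P = cauchy_rel M d `` {v}" by (auto simp: metric_boundary_iff)
      then show "0 \<le> completion_dist d (completion_embed M d z) P"
        using LIMSEQ_le_const[OF completion_embed_dist_tendsto[OF assms(1), of v], of 0] by simp
    qed
  qed (use assms metric_boundary_iff in blast)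
  also have "\<dots> \<le> B"
    using completion_embed_dist_tendsto[OF assms(1,2)] assms(4) by (auto intro: LIMSEQ_le_const2)
  finally show ?thesis .
qed

lemma dist_to_boundary_ge:
  assumes "z \<in> M" "\<not> mcomplete"
    and conv: "\<And>u. MCauchy u \<Longrightarrow> eventually (\<lambda>n. d z (u n) < B) sequentially \<Longrightarrow>
      \<exists>a. limitin mtopology u a sequentially"
  shows "B \<le> dist_to_boundary M d z"
  unfolding dist_to_boundary_def
proof (rule cINF_greatest)
  show "metric_boundary M d \<noteq> {}" using assms(2) metric_boundary_iff unfolding mcomplete_def by blast
  fix P assume "P \<in> metric_boundary M d"
  then obtain v where v: "MCauchy v" "P = cauchy_rel M d `` {v}" "\<nexists>a. limitin mtopology v a sequentially"
    by (auto simp: metric_boundary_iff)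
  show "B \<le> completion_dist d (completion_embed M d z) P"
  proof (rule ccontr)
    assume "\<not> ?thesis"
    then have "eventually (\<lambda>n. d z (v n) < B) sequentially"
      using completion_embed_dist_tendsto[OF assms(1) v(1)] v(2) by (intro order_tendstoD(2)) auto
    then show False using conv v by blast
  qed
qed

end

context harnack_density
begin

text \<open>
  A Cauchy sequence that stays at deformed distance less than \<open>exp (- k) * \<rho> z\<close> from \<open>z\<close> is
  eventually in the compact unit ball around \<open>z\<close>, and so it converges.
\<close>

lemma dist_to_boundary_ge:
  assumes "\<not> M.mcomplete" shows "exp (- k) * \<rho> z \<le> dist_to_boundary UNIV d z"
proof (rule M.dist_to_boundary_ge[OF UNIV_I assms])
  fix u assume u: "M.MCauchy u" and "eventually (\<lambda>n. d z (u n) < exp (- k) * \<rho> z) sequentially"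
  then have "eventually (\<lambda>n. dist z (u n) < 1) sequentially"
    by (auto elim!: eventually_mono intro!: dist_less_if_d_less)
  then obtain N where N: "\<And>n. n \<ge> N \<Longrightarrow> dist z (u n) < 1" by (auto simp: eventually_sequentially)
  have "compact (cball z 1)" using proper by (simp add: proper_space_def)
  then have "seq_compact (cball z 1)" by (rule compact_imp_seq_compact)
  moreover have "\<forall>n. u (N + n) \<in> cball z 1" using N by (simp add: less_imp_le)
  ultimately obtain a r where r: "strict_mono r" "((\<lambda>n. u (N + n)) \<circ> r) \<longlonglongrightarrow> a"
    unfolding seq_compact_def by meson
  have "strict_mono (\<lambda>n. N + r n)" using r(1) by (auto simp: strict_mono_def)
  moreover have "limitin M.mtopology (u \<circ> (\<lambda>n. N + r n)) a sequentially"
    using r(2) by (simp add: mtopology_eq o_def)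
  ultimately show "\<exists>a. limitin M.mtopology u a sequentially"
    using M.MCauchy_convergent_subsequence[OF u] by blast
qed

text \<open>
  A sequence with bounded steps along which \<open>\<rho>\<close> decays geometrically leaves every compact set,
  while its deformed length is finite.
\<close>

lemma geometric_sequence:
  assumes step: "\<And>n. dist (z n) (z (Suc n)) \<le> R"
    and decay: "\<And>n. \<rho> (z n) \<le> C * q ^ n" and q: "0 \<le> q" "q < 1"
  shows MCauchy_geometric_sequence: "M.MCauchy z"
    and not_convergent_geometric_sequence: "\<nexists>a. limitin M.mtopology z a sequentially"
    and dist_to_boundary_geometric_sequence:
      "dist_to_boundary UNIV d (z 0) \<le> exp (k * R) * R * C / (1 - q)"
proof -
  define E where "E = exp (k * R) * R * C / (1 - q)"
  have "0 \<le> R" using step[of 0] zero_le_dist order_trans by blast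
  have "0 < C" using decay[of 0] pos[of "z 0"] by simp
  have E: "0 \<le> E" using \<open>0 \<le> R\<close> \<open>0 < C\<close> q by (simp add: E_def)
  have E1: "exp (k * R) * R * C = E * (1 - q)" using q by (simp add: E_def)
  have dstep: "d (z n) (z (Suc n)) \<le> E * q ^ n - E * q ^ Suc n" for n
  proof -
    have "d (z n) (z (Suc n)) \<le> exp (k * R) * R * \<rho> (z n)" by (rule d_le'[OF step])
    also have "\<dots> \<le> exp (k * R) * R * (C * q ^ n)"
      using decay \<open>0 \<le> R\<close> by (intro mult_left_mono) auto
    also have "\<dots> = exp (k * R) * R * C * q ^ n" by simp
    also have "\<dots> = E * q ^ n - E * q ^ Suc n" unfolding E1 by (simp add: algebra_simps)
    finally show ?thesis .
  qed
  have "d (z m) (z n) \<le> E * q ^ m - E * q ^ n" if "m \<le> n" for m n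
    using that
  proof (induction n rule: dec_induct)
    case base
    then show ?case by (simp add: d_eq_0_iff)
  next
    case (step n)
    then show ?case using d_triangle[of "z m" "z (Suc n)" "z n"] dstep[of n] by linarith
  qed
  then have tail: "d (z m) (z n) \<le> E * q ^ m" if "m \<le> n" for m n
    using that E q by (smt (verit) mult_nonneg_nonneg zero_le_power)
  have lim0: "(\<lambda>n. E * q ^ n) \<longlonglongrightarrow> 0"
    using tendsto_mult_right_zero[OF LIMSEQ_power_zero[of q]] q by simp
  show cauchy: "M.MCauchy z"
    unfolding M.MCauchy_def
  proof (intro conjI allI impI)
    fix e :: real assume "e > 0"
    then obtain N where N: "\<And>n. n \<ge> N \<Longrightarrow> E * q ^ n < e"
      using order_tendstoD(2)[OF lim0] by (auto simp: eventually_sequentially)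
    have "d (z n) (z n') < e" if "N \<le> n" "N \<le> n'" for n n'
    proof (cases "n \<le> n'")
      case True then show ?thesis using tail[of n n'] N[of n] that by simp
    next
      case False then show ?thesis using tail[of n' n] N[of n'] that M.commute[of "z n"] by simp
    qed
    then show "\<exists>N. \<forall>n n'. N \<le> n \<longrightarrow> N \<le> n' \<longrightarrow> d (z n) (z n') < e" by blast
  qed simp
  show nonconv: "\<nexists>a. limitin M.mtopology z a sequentially"
  proof
    assume "\<exists>a. limitin M.mtopology z a sequentially"
    then obtain a where "z \<longlonglongrightarrow> a" by (auto simp: mtopology_eq)
    then have "(\<lambda>n. \<rho> (z n)) \<longlonglongrightarrow> \<rho> a"
      by (rule continuous_on_tendsto_compose[OF continuous[of UNIV]]) auto
    moreover have "(\<lambda>n. C * q ^ n) \<longlonglongrightarrow> 0"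
      using tendsto_mult_right_zero[OF LIMSEQ_power_zero[of q]] q by simp
    ultimately have "\<rho> a \<le> 0" using decay by (auto intro: LIMSEQ_le)
    then show False using pos[of a] by simp
  qed
  have "dist_to_boundary UNIV d (z 0) \<le> E"
    by (rule M.dist_to_boundary_le[OF UNIV_I cauchy nonconv]) (use tail[of 0] in simp)
  then show "dist_to_boundary UNIV d (z 0) \<le> exp (k * R) * R * C / (1 - q)" by (simp add: E_def)
qed

end

section \<open>Uniformity in terms of the density\<close>

context harnack_density
begin

text \<open>
  A uniform curve in terms of a 1-Lipschitz curve: deformed lengths are replaced by integrals of
  \<open>\<rho>\<close>, which dominate them, and the distance to the boundary is replaced by \<open>\<rho>\<close>, which it
  dominates up to a constant factor.
\<close>

definition uniform_curve :: "real \<Rightarrow> 'a \<Rightarrow> 'a \<Rightarrow> bool" where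
  "uniform_curve A x y \<longleftrightarrow> (\<exists>(L::real) g. 0 \<le> L \<and> 1-lipschitz_on {0..L} g \<and> g 0 = x \<and> g L = y \<and>
     integral {0..L} (\<lambda>s. \<rho> (g s)) \<le> A * d x y \<and>
     (\<forall>s\<in>{0..L}. min (integral {0..s} (\<lambda>s. \<rho> (g s))) (integral {s..L} (\<lambda>s. \<rho> (g s))) \<le> A * \<rho> (g s)))"

lemma uniform_curve_mono:
  assumes "uniform_curve A x y" "A \<le> A'" shows "uniform_curve A' x y"
proof -
  have "A * d x y \<le> A' * d x y" "\<And>z. A * \<rho> z \<le> A' * \<rho> z"
    using assms(2) d_nonneg nonneg by (auto intro: mult_right_mono)
  then show ?thesis
    using assms(1) unfolding uniform_curve_def
    by (elim exE conjE, intro exI conjI) (assumption | rule refl | blast intro: order_trans)+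
qed

lemma uniform_metric_spaceI:
  assumes ncomp: "\<not> M.mcomplete" and curve: "\<And>x y. uniform_curve A x y"
  shows "uniform_metric_space UNIV d"
proof -
  (* The factor exp k is lost when \<rho> is replaced by the distance to the boundary. *)
  define A' where "A' = max 1 (max A (A * exp k))"
  have "\<exists>\<gamma>. rectifiable_curve UNIV d \<gamma> x y \<and> curve_length d \<gamma> 0 1 \<le> ennreal (A' * d x y) \<and>
        (\<forall>t\<in>{0..1}. min (curve_length d \<gamma> 0 t) (curve_length d \<gamma> t 1)
                      \<le> ennreal (A' * dist_to_boundary UNIV d (\<gamma> t)))" for x y
  proof -
    obtain L :: real and g where L: "0 \<le> L" and g: "1-lipschitz_on {0..L} g" "g 0 = x" "g L = y"
      and len: "integral {0..L} (\<lambda>s. \<rho> (g s)) \<le> A * d x y"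
      and mid: "\<And>s. s \<in> {0..L} \<Longrightarrow>
        min (integral {0..s} (\<lambda>s. \<rho> (g s))) (integral {s..L} (\<lambda>s. \<rho> (g s))) \<le> A * \<rho> (g s)"
      using curve[of x y] unfolding uniform_curve_def by blast
    define \<gamma> where "\<gamma> t = g (L * t)" for t
    have rng: "L * t \<in> {0..L}" if "t \<in> {0..1}" for t
      using that L mult_left_mono[of t 1 L] by auto
    have clen: "curve_length d \<gamma> s t \<le> ennreal (integral {L * s..L * t} (\<lambda>s. \<rho> (g s)))"
      if st: "0 \<le> s" "s \<le> t" "t \<le> 1" for s t
    proof -
      define F where "F u = integral {0..L * u} (\<lambda>s. \<rho> (g s))" for u
      have F: "F v - F u = integral {L * u..L * v} (\<lambda>s. \<rho> (g s))"
        "1-lipschitz_on {L * u..L * v} g" "L * u \<le> L * v"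
        if "0 \<le> u" "u \<le> v" "v \<le> 1" for u v
      proof -
        have uv: "0 \<le> L * u" "L * u \<le> L * v" "L * v \<le> L"
          using that L rng[of v] by (auto intro: mult_left_mono)
        have g': "1-lipschitz_on {0..L * v} g" by (rule lipschitz_on_subset[OF g(1)]) (use uv in auto)
        show "F v - F u = integral {L * u..L * v} (\<lambda>s. \<rho> (g s))"
          using integral_along_combine[OF g' uv(1,2)] unfolding F_def by linarith
        show "1-lipschitz_on {L * u..L * v} g" by (rule lipschitz_on_subset[OF g(1)]) (use uv in auto)
        show "L * u \<le> L * v" by fact
      qed
      have "curve_length d \<gamma> s t \<le> ennreal (F t - F s)"
      proof (rule curve_length_le_increment)
        fix u v assume "s \<le> u" "u \<le> v" "v \<le> t"
        then have uv: "0 \<le> u" "u \<le> v" "v \<le> 1" using st by auto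
        show "d (\<gamma> u) (\<gamma> v) \<le> F v - F u"
          unfolding F(1)[OF uv] \<gamma>_def by (rule d_le_integral[OF F(2,3)[OF uv]])
        show "F u \<le> F v" using integral_along_nonneg[OF F(2)[OF uv]] F(1)[OF uv] by simp
      qed
      then show ?thesis using F(1)[OF st] by simp
    qed
    have "continuous_on {0..1} \<gamma>" unfolding \<gamma>_def
      by (intro continuous_on_compose2[OF lipschitz_on_continuous_on[OF g(1)]] continuous_intros)
        (use rng in auto)
    moreover have "curve_length d \<gamma> 0 1 < \<infinity>" using clen[of 0 1] by (auto intro: le_less_trans)
    ultimately have "rectifiable_curve UNIV d \<gamma> x y"
      using g(2,3) by (simp add: rectifiable_curve_def mtopology_eq pathin_euclidean \<gamma>_def)
    moreover have "curve_length d \<gamma> 0 1 \<le> ennreal (A' * d x y)"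
    proof -
      have "A * d x y \<le> A' * d x y" using d_nonneg by (intro mult_right_mono) (auto simp: A'_def)
      then show ?thesis using clen[of 0 1] len by (auto intro!: ennreal_leI elim!: order_trans)
    qed
    moreover have "min (curve_length d \<gamma> 0 t) (curve_length d \<gamma> t 1)
        \<le> ennreal (A' * dist_to_boundary UNIV d (\<gamma> t))" if t: "t \<in> {0..1}" for t
    proof -
      have "A * \<rho> (\<gamma> t) = A * exp k * (exp (- k) * \<rho> (\<gamma> t))" by (simp add: exp_minus field_simps)
      also have "\<dots> \<le> A' * (exp (- k) * \<rho> (\<gamma> t))"
        using nonneg by (intro mult_right_mono) (auto simp: A'_def)
      also have "\<dots> \<le> A' * dist_to_boundary UNIV d (\<gamma> t)"
        using dist_to_boundary_ge[OF ncomp] by (intro mult_left_mono) (auto simp: A'_def)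
      finally have le: "A * \<rho> (\<gamma> t) \<le> A' * dist_to_boundary UNIV d (\<gamma> t)" .
      have "integral {0..L * t} (\<lambda>s. \<rho> (g s)) \<le> A * \<rho> (\<gamma> t) \<or> integral {L * t..L} (\<lambda>s. \<rho> (g s)) \<le> A * \<rho> (\<gamma> t)"
        using mid[OF rng[OF t]] by (auto simp: \<gamma>_def min_le_iff_disj)
      then have "curve_length d \<gamma> 0 t \<le> ennreal (A' * dist_to_boundary UNIV d (\<gamma> t)) \<or>
        curve_length d \<gamma> t 1 \<le> ennreal (A' * dist_to_boundary UNIV d (\<gamma> t))"
        using clen[of 0 t] clen[of t 1] t le
        by (auto intro: order_trans[OF _ ennreal_leI])
      then show ?thesis by (auto simp: min_le_iff_disj)
    qed
    ultimately show ?thesis by blast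
  qed
  then have "uniform_metric_space_with A' UNIV d"
    unfolding uniform_metric_space_with_def
    using M.Metric_space_axioms locally_compact ncomp by blast
  then show ?thesis unfolding uniform_metric_space_def by (intro exI[of _ A']) (simp add: A'_def)
qed

text \<open>
  At bounded distance a geodesic will do, because by the Harnack inequality \<open>\<rho>\<close> varies along it by a
  bounded factor.  One factor \<open>exp (k * R)\<close> compares \<open>\<rho>\<close> on the geodesic with \<open>\<rho> x\<close>, the second one
  leads back to the density at an arbitrary point of it, and \<open>exp k * R\<close> comes from \<open>d_ge\<close>.
\<close>

lemma uniform_curve_near:
  assumes "1 \<le> R" "dist x y \<le> R"
  shows "uniform_curve (exp (k * R) * exp (k * R) * exp k * R) x y"
proof -
  define L where "L = dist x y"
  obtain g where g: "1-lipschitz_on {0..L} g" "g 0 = x" "g L = y"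
    unfolding L_def by (rule geodesic_lipschitz[OF geodesic])
  have L: "0 \<le> L" "L \<le> R" using assms by (auto simp: L_def)
  have dg: "dist (g s) x \<le> R" if "s \<in> {0..L}" for s
    using lipschitz_onD[OF g(1), of s 0] that g(2) L by (auto simp: dist_real_def)
  have int: "integral {0..L} (\<lambda>s. \<rho> (g s)) \<le> exp (k * R) * \<rho> x * L"
    using integral_along_le[OF g(1) L(1), of x R] dg by simp
  have ek: "1 \<le> exp k" "1 \<le> exp (k * R)" using k_nonneg assms by auto
  have "exp (k * R) * \<rho> x * L \<le> exp (k * R) * \<rho> x * (R * min 1 L)"
  proof (intro mult_left_mono)
    show "L \<le> R * min 1 L" using assms(1) L mult_right_mono[of 1 R L] by (simp add: min_def)
  qed (use nonneg in auto)
  also have "\<dots> = (exp (k * R) * exp k * R) * (exp (- k) * \<rho> x * min 1 L)"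
    by (simp add: exp_minus)
  also have "\<dots> \<le> (exp (k * R) * exp k * R) * d x y"
    using d_ge[of x y] assms(1) by (intro mult_left_mono) (auto simp: L_def)
  also have "\<dots> \<le> (exp (k * R) * exp k * R) * d x y * exp (k * R)"
    using mult_left_mono[OF ek(2), of "(exp (k * R) * exp k * R) * d x y"] d_nonneg assms(1) by simp
  finally have "exp (k * R) * \<rho> x * L \<le> exp (k * R) * exp (k * R) * exp k * R * d x y"
    by (simp only: mult_ac)
  note 1 = order_trans[OF int this]
  have 2: "integral {0..s} (\<lambda>s. \<rho> (g s)) \<le> exp (k * R) * exp (k * R) * exp k * R * \<rho> (g s)"
    if s: "s \<in> {0..L}" for s
  proof -
    have "integral {0..s} (\<lambda>s. \<rho> (g s)) \<le> integral {0..L} (\<lambda>s. \<rho> (g s))"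
      by (rule integral_along_mono[OF g(1)]) (use s in auto)
    also have "\<dots> \<le> exp (k * R) * \<rho> x * R"
      by (rule order_trans[OF int mult_left_mono[OF L(2)]]) (use nonneg in simp)
    also have "\<dots> \<le> exp (k * R) * (exp (k * R) * \<rho> (g s)) * R"
      using harnack_le[of x "g s" R] dg[OF s] assms(1)
      by (intro mult_right_mono mult_left_mono) (auto simp: dist_commute)
    also have "\<dots> \<le> exp (k * R) * (exp (k * R) * \<rho> (g s)) * R * exp k"
      using mult_left_mono[OF ek(1), of "exp (k * R) * (exp (k * R) * \<rho> (g s)) * R"]
        nonneg[of "g s"] assms(1) by simp
    finally show ?thesis by (simp add: mult_ac)
  qed
  show ?thesis
    unfolding uniform_curve_def
    by (rule exI[of _ L], rule exI[of _ g]) (use L g 1 2 in \<open>auto intro: min.coboundedI1\<close>)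
qed

text \<open>
  Every segment gets the same duration \<open>D\<close>, whatever its length, so that the \<open>i\<close>-th vertex is
  reached at time \<open>i * D\<close>.
\<close>

lemma polygonal_curve:
  fixes q :: "nat \<Rightarrow> 'a"
  assumes "0 < D" "\<And>i. i < N \<Longrightarrow> dist (q i) (q (Suc i)) \<le> D"
  shows "\<exists>g. 1-lipschitz_on {0..real N * D} g \<and> (\<forall>i\<le>N. g (real i * D) = q i)"
  using assms(2)
proof (induction N)
  case 0
  then show ?case by (intro exI[of _ "\<lambda>_. q 0"]) (auto simp: lipschitz_on_def)
next
  case (Suc N)
  then obtain g where g: "1-lipschitz_on {0..real N * D} g" "\<And>i. i \<le> N \<Longrightarrow> g (real i * D) = q i"
    by fastforce
  define e where "e = dist (q N) (q (Suc N))"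
  have e: "0 \<le> e" "e \<le> D" using Suc.prems[of N] by (auto simp: e_def)
  obtain h where h: "1-lipschitz_on {0..e} h" "h 0 = q N" "h e = q (Suc N)"
    unfolding e_def by (rule geodesic_lipschitz[OF geodesic])
  define b where "b = real N * D"
  define j where "j s = h (e / D * (s - b))" for s
  have "1-lipschitz_on {b..b + D} j"
  proof (rule lipschitz_onI)
    fix s t assume st: "s \<in> {b..b + D}" "t \<in> {b..b + D}"
    have rng: "e / D * (s - b) \<in> {0..e}" if "s \<in> {b..b + D}" for s
    proof -
      have "0 \<le> e / D" "0 \<le> s - b" "s - b \<le> D" using that e assms(1) by auto
      then have "0 \<le> e / D * (s - b)" "e / D * (s - b) \<le> e / D * D"
        by (auto intro!: mult_left_mono simp del: times_divide_eq_left)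
      then show ?thesis using assms(1) by simp
    qed
    have "dist (j s) (j t) \<le> 1 * dist (e / D * (s - b)) (e / D * (t - b))"
      unfolding j_def by (rule lipschitz_onD[OF h(1)]) (use rng st in auto)
    also have "\<dots> = \<bar>e / D * (s - t)\<bar>"
      by (simp only: dist_real_def right_diff_distrib[symmetric]) simp
    also have "\<dots> = e / D * \<bar>s - t\<bar>" using e assms(1) by (simp add: abs_mult)
    also have "\<dots> \<le> 1 * \<bar>s - t\<bar>" using e assms(1) by (intro mult_right_mono) auto
    finally show "dist (j s) (j t) \<le> 1 * dist s t" by (simp add: dist_real_def)
  qed simp
  then have "1-lipschitz_on {0..b + D} (\<lambda>s. if s \<le> b then g s else j s)"
    using g h(2) by (intro lipschitz_on_concat) (auto simp: b_def j_def)
  moreover have "(if real i * D \<le> b then g (real i * D) else j (real i * D)) = q i" if "i \<le> Suc N" for i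
  proof (cases "i \<le> N")
    case True then show ?thesis using g(2) assms(1) by (simp add: b_def)
  next
    case False
    then have "i = Suc N" using that by simp
    then show ?thesis using h(3) assms(1) by (simp add: b_def j_def algebra_simps)
  qed
  ultimately show ?case by (intro exI[of _ "\<lambda>s. if s \<le> b then g s else j s"]) (simp add: b_def algebra_simps)
qed

end

text \<open>
  From time \<open>a\<close> the next cutting time is any later time at distance one.  By uniform continuity it
  is at least \<open>\<eta>\<close> later, which bounds the number of steps by \<open>m\<close>.
\<close>

lemma unit_step_subdivision_aux:
  fixes \<gamma> :: "real \<Rightarrow> 'a::metric_space"
  assumes cont: "continuous_on {0..1} \<gamma>" and "0 < \<eta>"
    and \<eta>: "\<And>s t. s \<in> {0..1} \<Longrightarrow> t \<in> {0..1} \<Longrightarrow> \<bar>s - t\<bar> < \<eta> \<Longrightarrow> dist (\<gamma> s) (\<gamma> t) < 1"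
    and "0 \<le> a" "a \<le> 1" "1 - a \<le> real m * \<eta>"
  shows "\<exists>n t. t 0 = a \<and> (\<forall>i<n. t i \<le> t (Suc i) \<and> dist (\<gamma> (t i)) (\<gamma> (t (Suc i))) = 1) \<and>
    t n \<le> (1::real) \<and> dist (\<gamma> (t n)) (\<gamma> 1) < 1"
  using assms(4-6)
proof (induction m arbitrary: a)
  case 0
  then show ?case by (intro exI[of _ 0] exI[of _ "\<lambda>_. a"]) auto
next
  case (Suc m)
  show ?case
  proof (cases "dist (\<gamma> a) (\<gamma> 1) < 1")
    case True
    then show ?thesis using Suc.prems by (intro exI[of _ 0] exI[of _ "\<lambda>_. a"]) auto
  next
    case False
    have "continuous_on {a..1} (\<lambda>t. dist (\<gamma> a) (\<gamma> t))"
      by (intro continuous_intros continuous_on_subset[OF cont]) (use Suc.prems in auto)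
    then obtain b where b: "a \<le> b" "b \<le> 1" "dist (\<gamma> a) (\<gamma> b) = 1"
      using IVT'[of "\<lambda>t. dist (\<gamma> a) (\<gamma> t)" a 1 1] False Suc.prems by auto
    then have "\<eta> \<le> b - a" using \<eta>[of a b] Suc.prems by force
    then have "1 - b \<le> real m * \<eta>" using Suc.prems(3) by (simp add: algebra_simps)
    then obtain n t where t: "t 0 = b" "\<forall>i<n. t i \<le> t (Suc i) \<and> dist (\<gamma> (t i)) (\<gamma> (t (Suc i))) = 1"
      "t n \<le> 1" "dist (\<gamma> (t n)) (\<gamma> 1) < 1"
      using Suc.IH[of b] Suc.prems b by auto
    define t' where "t' = case_nat a t"
    have "\<forall>i<Suc n. t' i \<le> t' (Suc i) \<and> dist (\<gamma> (t' i)) (\<gamma> (t' (Suc i))) = 1"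
      using t b by (auto simp: t'_def split: nat.split)
    then show ?thesis using t by (intro exI[of _ "Suc n"] exI[of _ t']) (auto simp: t'_def)
  qed
qed

lemma unit_step_subdivision:
  fixes \<gamma> :: "real \<Rightarrow> 'a::metric_space"
  assumes cont: "continuous_on {0..1} \<gamma>"
  shows "\<exists>n t. t 0 = 0 \<and> (\<forall>i<n. t i \<le> t (Suc i) \<and> dist (\<gamma> (t i)) (\<gamma> (t (Suc i))) = 1) \<and>
    t n \<le> (1::real) \<and> dist (\<gamma> (t n)) (\<gamma> 1) < 1"
proof -
  have "uniformly_continuous_on {0..1} \<gamma>" using cont by (rule compact_uniformly_continuous) simp
  then obtain \<eta> where "0 < \<eta>"
    and \<eta>: "\<And>s t. s \<in> {0..1} \<Longrightarrow> t \<in> {0..1} \<Longrightarrow> dist s t < \<eta> \<Longrightarrow> dist (\<gamma> s) (\<gamma> t) < 1"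
    unfolding uniformly_continuous_on_def by (metis zero_less_one)
  obtain m :: nat where "1 < real m * \<eta>" using reals_Archimedean3[OF \<open>0 < \<eta>\<close>] by blast
  then show ?thesis
    by (intro unit_step_subdivision_aux[OF cont \<open>0 < \<eta>\<close>, where m = m]) (use \<eta> in \<open>auto simp: dist_real_def\<close>)
qed

section \<open>Transfer of uniformity along a rough isometry\<close>

locale comparable_densities =
  X: harnack_density \<rho>\<^sub>X k + Y: harnack_density \<rho>\<^sub>Y k
  for \<rho>\<^sub>X :: "'x::metric_space \<Rightarrow> real" and \<rho>\<^sub>Y :: "'y::metric_space \<Rightarrow> real" and k :: real +
  fixes \<phi> :: "'y \<Rightarrow> 'x" and l \<tau> C :: real
  assumes l_nonneg: "0 \<le> l" and \<tau>_nonneg: "0 \<le> \<tau>"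
    and rough_upper: "\<And>y y'. dist (\<phi> y) (\<phi> y') \<le> dist y y' + l"
    and rough_lower: "\<And>y y'. dist y y' \<le> dist (\<phi> y) (\<phi> y') + l"
    and dense: "\<And>x. \<exists>y. dist x (\<phi> y) \<le> \<tau>"
    and \<rho>\<^sub>X_le: "\<And>y. \<rho>\<^sub>X (\<phi> y) \<le> C * \<rho>\<^sub>Y y"
    and \<rho>\<^sub>Y_le: "\<And>y. \<rho>\<^sub>Y y \<le> C * \<rho>\<^sub>X (\<phi> y)"
begin

lemma C_pos: "0 < C"
proof -
  fix y :: 'y
  have "0 < C * \<rho>\<^sub>Y y" using \<rho>\<^sub>X_le[of y] X.pos[of "\<phi> y"] by linarith
  then show ?thesis using Y.pos[of y] by (simp add: zero_less_mult_iff)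
qed

text \<open>
  A curve from \<open>y\<close> to \<open>y'\<close> in \<open>Y\<close>, cut at unit times, is sent to a chain with steps at most
  \<open>1 + l\<close> in \<open>X\<close>.  The remainder of duration less than \<open>1\<close> at the end is charged to the unit step
  before it, which exists because \<open>y\<close> and \<open>y'\<close> are not close to each other.
\<close>

lemma conformal_dist_image_le:
  assumes "1 \<le> dist y y'"
  shows "X.d (\<phi> y) (\<phi> y') \<le> exp (k * (1 + l)) * (1 + l) * C * (1 + exp k) * exp k * Y.d y y'"
proof -
  define B where "B = exp (k * (1 + l)) * (1 + l) * C"
  have B: "0 < B" using l_nonneg C_pos by (simp add: B_def)
  have step: "X.d (\<phi> z) (\<phi> z') \<le> B * \<rho>\<^sub>Y z" if "dist z z' \<le> 1" for z z'
  proof -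
    have "dist (\<phi> z) (\<phi> z') \<le> 1 + l" using rough_upper[of z z'] that by simp
    then have "X.d (\<phi> z) (\<phi> z') \<le> exp (k * (1 + l)) * (1 + l) * \<rho>\<^sub>X (\<phi> z)" by (rule X.d_le')
    also have "\<dots> \<le> exp (k * (1 + l)) * (1 + l) * (C * \<rho>\<^sub>Y z)"
      using \<rho>\<^sub>X_le l_nonneg by (intro mult_left_mono) auto
    finally show ?thesis by (simp add: B_def mult.assoc)
  qed
  define K where "K = B * (1 + exp k) * exp k"
  have K: "0 < K" using B by (simp add: K_def add_pos_pos)
  have main: "X.d (\<phi> y) (\<phi> y') \<le> K * integral {0..L} (\<lambda>s. \<rho>\<^sub>Y (g s))"
    if g: "0 \<le> L" "1-lipschitz_on {0..L} g" "g 0 = y" "g L = y'" for L :: real and g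
  proof -
    have "dist y y' \<le> L" using lipschitz_onD[OF g(2), of 0 L] g by (simp add: dist_real_def)
    then have "1 \<le> L" using assms by simp
    define N where "N = nat \<lfloor>L\<rfloor>"
    have N: "real N \<le> L" "L < real N + 1" "1 \<le> N"
      using \<open>1 \<le> L\<close> by (auto simp: N_def le_nat_floor)
    have dg: "dist (g s) (g t) \<le> 1" if "s \<in> {0..L}" "t \<in> {0..L}" "\<bar>s - t\<bar> \<le> 1" for s t
      using lipschitz_onD[OF g(2) that(1,2)] that(3) by (simp add: dist_real_def)
    define S where "S i = (\<Sum>j<i. \<rho>\<^sub>Y (g (real j)))" for i
    have chain: "X.d (\<phi> y) (\<phi> (g (real i))) \<le> B * S i" if "i \<le> N" for i
      using that
    proof (induction i)
      case 0
      then show ?case using g by (simp add: S_def X.d_eq_0_iff)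
    next
      case (Suc i)
      have "X.d (\<phi> (g (real i))) (\<phi> (g (real (Suc i)))) \<le> B * \<rho>\<^sub>Y (g (real i))"
        using Suc.prems N by (intro step dg) auto
      then show ?case
        using Suc X.d_triangle[of "\<phi> y" "\<phi> (g (real (Suc i)))" "\<phi> (g (real i))"]
        by (simp add: S_def algebra_simps)
    qed
    have int: "exp (- k) * S i \<le> integral {0..real i} (\<lambda>s. \<rho>\<^sub>Y (g s))" if "i \<le> N" for i
      using that
    proof (induction i)
      case 0
      then show ?case by (simp add: S_def)
    next
      case (Suc i)
      have lip: "1-lipschitz_on {0..real (Suc i)} g" "1-lipschitz_on {real i..real (Suc i)} g"
        using Suc.prems N by (auto intro: lipschitz_on_subset[OF g(2)])
      have "exp (- k * 1) * \<rho>\<^sub>Y (g (real i)) * (real (Suc i) - real i)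
          \<le> integral {real i..real (Suc i)} (\<lambda>s. \<rho>\<^sub>Y (g s))"
        by (rule Y.integral_along_ge[OF lip(2)]) (use Suc.prems N in \<open>auto intro!: dg\<close>)
      then show ?case
        using Suc Y.integral_along_combine[OF lip(1), of "real i"] by (simp add: S_def algebra_simps)
    qed
    have last: "\<rho>\<^sub>Y (g (real N)) \<le> exp k * S N"
    proof -
      obtain m where m: "N = Suc m" using N(3) by (cases N) auto
      have "\<rho>\<^sub>Y (g (real N)) \<le> exp (k * 1) * \<rho>\<^sub>Y (g (real m))"
        by (rule Y.harnack_le, rule dg) (use N m in auto)
      also have "\<dots> \<le> exp (k * 1) * S N"
        unfolding S_def m using Y.nonneg by (intro mult_left_mono) (auto intro: sum_nonneg)
      finally show ?thesis by simp
    qed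
    have "X.d (\<phi> (g (real N))) (\<phi> y') \<le> B * \<rho>\<^sub>Y (g (real N))"
      unfolding g(4)[symmetric] using N g(1) by (intro step dg) auto
    also have "\<dots> \<le> B * (exp k * S N)" using last B by simp
    finally have "X.d (\<phi> y) (\<phi> y') \<le> B * S N + B * (exp k * S N)"
      using chain[of N] X.d_triangle[of "\<phi> y" "\<phi> y'" "\<phi> (g (real N))"] by simp
    also have "\<dots> = K * (exp (- k) * S N)"
      by (simp add: K_def exp_minus algebra_simps)
    also have "\<dots> \<le> K * integral {0..L} (\<lambda>s. \<rho>\<^sub>Y (g s))"
      using order_trans[OF int[OF order_refl] Y.integral_along_mono[OF g(2), of 0 "real N"]] N K
      by (intro mult_left_mono) auto
    finally show ?thesis .
  qed
  have "X.d (\<phi> y) (\<phi> y') / K \<le> Y.d y y'"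
  proof (rule Y.d_greatest)
    fix L and g :: "real \<Rightarrow> 'y"
    assume "0 \<le> L" "1-lipschitz_on {0..L} g" "g 0 = y" "g L = y'"
    from main[OF this] show "X.d (\<phi> y) (\<phi> y') / K \<le> integral {0..L} (\<lambda>s. \<rho>\<^sub>Y (g s))"
      using K by (simp add: field_simps)
  qed
  then have "X.d (\<phi> y) (\<phi> y') \<le> K * Y.d y y'" using K by (simp add: field_simps)
  then show ?thesis by (simp add: K_def B_def)
qed

end

context comparable_densities
begin

text \<open>
  The first summand is the factor for the length of the lifted curve, the second one that for its
  length up to the nearer endpoint.  \<open>D\<close> bounds the distance of consecutive lifted points, and \<open>c * \<rho>\<^sub>X x\<close> bounds
  the deformed length of the lift of a piece that starts at \<open>x\<close>.
\<close>

definition far_const :: "real \<Rightarrow> real \<Rightarrow> real" where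
  "far_const A B = (let D = 1 + 2 * \<tau> + l; c = exp (k * D) * D * (C * exp (k * \<tau>)) in
     c * (1 + exp k) * (exp k * A) * (exp (k * (1 + l)) * (1 + l) * C * (1 + exp k) * exp k)
     + c * (1 + exp k) * (1 + exp k * A * B) * (exp (k * \<tau>) * C * exp (k * D)))"

text \<open>
  Below, \<open>r i\<close> is the density at the \<open>i\<close>-th cutting point and \<open>S a b\<close> the sum of these densities from
  \<open>a\<close> to \<open>b\<close>.  Deformed lengths of pieces of the curve in \<open>X\<close> are bounded below by multiples of \<open>S\<close>
  (\<open>S_le\<close>), and integrals along its lift \<open>g\<close> are bounded above by multiples of \<open>S\<close> (\<open>I_le\<close>).  The last
  piece may be short in \<open>X\<close> while its lift is not; it is charged to the piece before it (\<open>final\<close>).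
  That piece exists because \<open>\<phi> y\<close> and \<open>\<phi> y'\<close> have distance greater than one.
\<close>

lemma uniform_curve_far:
  assumes unif: "uniform_metric_space_with A UNIV X.d" and "1 \<le> A" "0 \<le> B"
    and bdry: "\<And>x. dist_to_boundary UNIV X.d x \<le> B * \<rho>\<^sub>X x"
    and far: "1 + l < dist y y'"
  shows "Y.uniform_curve (far_const A B) y y'"
proof -
  define D where "D = 1 + 2 * \<tau> + l"
  have D: "1 \<le> D" using \<tau>_nonneg l_nonneg by (simp add: D_def)
  define E where "E = exp k"
  have E: "1 \<le> E" "0 < E" using X.k_nonneg by (auto simp: E_def)
  define c where "c = exp (k * D) * D * (C * exp (k * \<tau>))"
  have c: "0 < c" using D C_pos by (simp add: c_def)

  obtain \<gamma> where \<gamma>: "rectifiable_curve UNIV X.d \<gamma> (\<phi> y) (\<phi> y')"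
    and len: "curve_length X.d \<gamma> 0 1 \<le> ennreal (A * X.d (\<phi> y) (\<phi> y'))"
    and mid: "\<And>t. t \<in> {0..1} \<Longrightarrow> min (curve_length X.d \<gamma> 0 t) (curve_length X.d \<gamma> t 1)
                      \<le> ennreal (A * dist_to_boundary UNIV X.d (\<gamma> t))"
    using unif unfolding uniform_metric_space_with_def by blast
  have \<gamma>01: "\<gamma> 0 = \<phi> y" "\<gamma> 1 = \<phi> y'" and cont: "continuous_on {0..1} \<gamma>"
    using \<gamma> by (auto simp: rectifiable_curve_def X.mtopology_eq pathin_euclidean)
  obtain n t where t0: "t 0 = (0::real)"
    and t_step: "\<forall>i<n. t i \<le> t (Suc i) \<and> dist (\<gamma> (t i)) (\<gamma> (t (Suc i))) = 1"
    and t_end: "t n \<le> 1" "dist (\<gamma> (t n)) (\<gamma> 1) < 1"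
    using unit_step_subdivision[OF cont] by blast
  then have t: "t 0 = 0" "\<And>i. i < n \<Longrightarrow> t i \<le> t (Suc i)"
    "\<And>i. i < n \<Longrightarrow> dist (\<gamma> (t i)) (\<gamma> (t (Suc i))) = 1" "t n \<le> 1" "dist (\<gamma> (t n)) (\<gamma> 1) < 1"
    by auto
  have "1 < dist (\<phi> y) (\<phi> y')" using rough_lower[of y y'] far by linarith
  then have "0 < n" using t(1,5) \<gamma>01 by (cases n) auto
  have tmono: "t i \<le> t j" if "i \<le> j" "j \<le> n" for i j
    using partition_mono[where t = t and n = n, OF t(2)] that by blast
  have t01: "0 \<le> t i" "t i \<le> 1" if "i \<le> n" for i
    using tmono[of 0 i] tmono[of i n] t(1,4) that by auto

  define r where "r i = \<rho>\<^sub>X (\<gamma> (t i))" for i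
  have r: "0 < r i" for i by (simp add: r_def X.pos)
  define S where "S a b = (\<Sum>j=a..<b. r j)" for a b
  have S_nonneg: "0 \<le> S a b" for a b using r by (auto simp: S_def intro: sum_nonneg less_imp_le)

  (* Each unit step costs at least a fixed multiple of the density at its start. *)
  have S_le: "ennreal (S a b / E) \<le> curve_length X.d \<gamma> (t a) (t b)" if "a \<le> b" "b \<le> n" for a b
  proof -
    have "S a b / E = (\<Sum>j=a..<b. exp (- k) * r j)"
      by (simp add: S_def E_def exp_minus sum_distrib_left divide_inverse mult.commute)
    also have "\<dots> \<le> (\<Sum>j=a..<b. X.d (\<gamma> (t j)) (\<gamma> (t (Suc j))))"
    proof (rule sum_mono)
      fix j assume "j \<in> {a..<b}"
      then show "exp (- k) * r j \<le> X.d (\<gamma> (t j)) (\<gamma> (t (Suc j)))"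
        using X.d_ge[of "\<gamma> (t j)" "\<gamma> (t (Suc j))"] t(3)[of j] that by (simp add: r_def)
    qed
    also have "(\<Sum>j=a..<b. X.d (\<gamma> (t j)) (\<gamma> (t (Suc j))))
        = (\<Sum>j<b - a. X.d (\<gamma> (t (a + j))) (\<gamma> (t (Suc (a + j)))))"
      using that(1) by (subst sum.atLeastLessThan_shift_0) (simp add: add.commute lessThan_atLeast0)
    finally have "ennreal (S a b / E) \<le> (\<Sum>j<b - a. ennreal (X.d (\<gamma> (t (a + j))) (\<gamma> (t (a + Suc j)))))"
      by (simp add: sum_ennreal X.d_nonneg ennreal_leI)
    also have "\<dots> \<le> curve_length X.d \<gamma> (t a) (t b)"
      by (rule sum_le_curve_length[where t = "\<lambda>j. t (a + j)"]) (use that t(2) in auto)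
    finally show ?thesis .
  qed
  (* The short remainder of the curve after the last cutting point is discarded. *)
  have S_le1: "ennreal (S a n / E) \<le> curve_length X.d \<gamma> (t a) 1" if "a \<le> n" for a
  proof -
    have "curve_length X.d \<gamma> (t a) (t n) \<le> curve_length X.d \<gamma> (t a) (t n) + curve_length X.d \<gamma> (t n) 1"
      by simp
    also have "\<dots> \<le> curve_length X.d \<gamma> (t a) 1"
      by (rule curve_length_superadditive) (use that tmono t(4) in auto)
    finally show ?thesis using S_le[OF that order_refl] by (rule order_trans[rotated])
  qed
  have total: "S 0 n \<le> E * A * X.d (\<phi> y) (\<phi> y')"
  proof -
    have "ennreal (S 0 n / E) \<le> ennreal (A * X.d (\<phi> y) (\<phi> y'))"
      using order_trans[OF S_le1[of 0] _] len t(1) by simp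
    then have "S 0 n / E \<le> A * X.d (\<phi> y) (\<phi> y')"
      by (subst (asm) ennreal_le_iff) (use \<open>1 \<le> A\<close> X.d_nonneg in auto)
    then show ?thesis using E by (simp add: field_simps)
  qed
  (* The curve is uniform at the cutting point, whose distance to the boundary is at most B * r i. *)
  have middle: "min (S 0 i) (S i n) \<le> E * A * B * r i" if i: "i \<le> n" for i
  proof -
    have "min (curve_length X.d \<gamma> 0 (t i)) (curve_length X.d \<gamma> (t i) 1)
        \<le> ennreal (A * dist_to_boundary UNIV X.d (\<gamma> (t i)))"
      using t01[OF i] by (intro mid) auto
    also have "\<dots> \<le> ennreal (A * (B * r i))"
      using bdry \<open>1 \<le> A\<close> by (intro ennreal_leI mult_left_mono) (auto simp: r_def)
    finally have "ennreal (S 0 i / E) \<le> ennreal (A * (B * r i)) \<or> ennreal (S i n / E) \<le> ennreal (A * (B * r i))"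
      using S_le[of 0 i] S_le1[OF i] i t(1) by (auto simp: min_le_iff_disj)
    moreover have "0 \<le> A * (B * r i)" using \<open>1 \<le> A\<close> \<open>0 \<le> B\<close> r[of i] by simp
    ultimately have "S 0 i / E \<le> A * (B * r i) \<or> S i n / E \<le> A * (B * r i)" by simp
    then show ?thesis using E by (auto simp: min_le_iff_disj field_simps)
  qed
  (* Cutting point n - 1 is at distance one from cutting point n, and n > i. *)
  have final: "r n \<le> E * S i n" if "i < n" for i
  proof -
    obtain m where m: "n = Suc m" using \<open>0 < n\<close> by (cases n) auto
    have "r n \<le> exp (k * 1) * r m"
      unfolding r_def by (rule X.harnack_le) (use t(3)[of m] m in \<open>simp add: dist_commute\<close>)
    moreover have "r m \<le> S i n"
      unfolding S_def by (rule member_le_sum) (use m that r in \<open>auto intro: less_imp_le\<close>)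
    ultimately have "r n \<le> exp k * r m" "exp k * r m \<le> exp k * S i n" by auto
    then show ?thesis unfolding E_def by (rule order_trans)
  qed
  have last: "S i (Suc n) \<le> (1 + E) * S i n + r i" if "i \<le> n" for i
  proof (cases "i = n")
    case True then show ?thesis by (simp add: S_def)
  next
    case False
    then show ?thesis using that final[of i] r[of i] by (simp add: S_def algebra_simps)
  qed

  obtain \<psi> where \<psi>: "\<And>x. dist x (\<phi> (\<psi> x)) \<le> \<tau>" using dense by metis
  define q where "q i = (if i = 0 then y else if i = Suc n then y' else \<psi> (\<gamma> (t i)))" for i
  have q0: "q 0 = y" "q (Suc n) = y'" by (auto simp: q_def)
  have q\<gamma>: "dist (\<gamma> (t i)) (\<phi> (q i)) \<le> \<tau>" if "i \<le> n" for i
    using that \<psi> \<tau>_nonneg t(1) \<gamma>01 by (auto simp: q_def)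
  have qstep: "dist (q i) (q (Suc i)) \<le> D" if "i < Suc n" for i
  proof -
    have i: "i \<le> n" using that by simp
    define w where "w = (if i = n then \<gamma> 1 else \<gamma> (t (Suc i)))"
    have "dist (\<gamma> (t i)) w \<le> 1" using t(3)[of i] t(5) i by (auto simp: w_def)
    moreover have "dist w (\<phi> (q (Suc i))) \<le> \<tau>"
      using q\<gamma>[of "Suc i"] i q0 \<gamma>01 \<tau>_nonneg by (auto simp: w_def)
    moreover have "dist (\<phi> (q i)) (\<gamma> (t i)) \<le> \<tau>" using q\<gamma>[OF i] by (simp add: dist_commute)
    ultimately have "dist (\<phi> (q i)) (\<phi> (q (Suc i))) \<le> \<tau> + 1 + \<tau>"
      using dist_triangle[of "\<phi> (q i)" "\<phi> (q (Suc i))" "\<gamma> (t i)"]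
        dist_triangle[of "\<gamma> (t i)" "\<phi> (q (Suc i))" w] by linarith
    then show ?thesis using rough_lower[of "q i" "q (Suc i)"] by (simp add: D_def)
  qed
  obtain g where g: "1-lipschitz_on {0..real (Suc n) * D} g"
    and gq: "\<And>i. i \<le> Suc n \<Longrightarrow> g (real i * D) = q i"
    using Y.polygonal_curve[of D "Suc n" q] D qstep by fastforce
  define L where "L = real (Suc n) * D"
  have L: "0 \<le> L" using D by (simp add: L_def)
  have iD: "0 \<le> real i * D" "real i * D \<le> L" "real i * D \<le> real (Suc i) * D" if "i \<le> Suc n" for i
    using that D by (auto simp: L_def intro!: mult_right_mono)
  note g = g[folded L_def]
  have lip: "1-lipschitz_on {a..b} g" if "0 \<le> a" "b \<le> L" for a b
    by (rule lipschitz_on_subset[OF g]) (use that in auto)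
  define I where "I a b = integral {a..b} (\<lambda>s. \<rho>\<^sub>Y (g s))" for a b
  have gd: "dist (g s) (q i) \<le> D" if "i \<le> n" "s \<in> {real i * D..real (Suc i) * D}" for i s
  proof -
    have "dist (g s) (g (real i * D)) \<le> 1 * dist s (real i * D)"
      using that iD[of i] iD[of "Suc i"] by (intro lipschitz_onD[OF g]) auto
    also have "\<dots> \<le> D" using that by (auto simp: dist_real_def algebra_simps)
    finally show ?thesis using gq that by simp
  qed
  have \<rho>q: "\<rho>\<^sub>Y (q i) \<le> C * exp (k * \<tau>) * r i" if "i \<le> n" for i
  proof -
    have "\<rho>\<^sub>Y (q i) \<le> C * \<rho>\<^sub>X (\<phi> (q i))" by (rule \<rho>\<^sub>Y_le)
    also have "\<dots> \<le> C * (exp (k * \<tau>) * r i)"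
      unfolding r_def using q\<gamma>[OF that] C_pos
      by (intro mult_left_mono X.harnack_le) (auto simp: dist_commute)
    finally show ?thesis by simp
  qed
  have I_le: "I (real a * D) (real b * D) \<le> c * S a b" if "a \<le> b" "b \<le> Suc n" for a b
    using that
  proof (induction b rule: dec_induct)
    case base
    then show ?case by (simp add: I_def S_def)
  next
    case (step b)
    then have b: "b \<le> n" by simp
    have "I (real b * D) (real (Suc b) * D) \<le> exp (k * D) * \<rho>\<^sub>Y (q b) * (real (Suc b) * D - real b * D)"
      unfolding I_def using iD[of b] iD[of "Suc b"] b gd
      by (intro Y.integral_along_le lip) auto
    also have "\<dots> = exp (k * D) * D * \<rho>\<^sub>Y (q b)" by (simp add: algebra_simps)
    also have "\<dots> \<le> exp (k * D) * D * (C * exp (k * \<tau>) * r b)"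
      using \<rho>q[OF b] D by (intro mult_left_mono) auto
    finally have "I (real b * D) (real (Suc b) * D) \<le> c * r b" by (simp add: c_def mult.assoc)
    moreover have "I (real a * D) (real b * D) + I (real b * D) (real (Suc b) * D) = I (real a * D) (real (Suc b) * D)"
      unfolding I_def using step b iD[of a] iD[of b] iD[of "Suc b"] D
      by (intro Y.integral_along_combine lip) (auto intro!: mult_right_mono)
    moreover have "S a (Suc b) = S a b + r b" using step by (simp add: S_def)
    ultimately show ?case using step by (simp add: algebra_simps)
  qed
  have I_mono: "I a b \<le> I a' b'" if "0 \<le> a'" "a' \<le> a" "a \<le> b" "b \<le> b'" "b' \<le> L" for a b a' b'
    unfolding I_def by (rule Y.integral_along_mono[OF lip]) (use that in auto)

  define A1 where "A1 = c * (1 + E) * (E * A) * (exp (k * (1 + l)) * (1 + l) * C * (1 + E) * E)"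
  define A2 where "A2 = c * (1 + E) * (1 + E * A * B) * (exp (k * \<tau>) * C * exp (k * D))"
  have A12: "far_const A B = A1 + A2"
    unfolding far_const_def A1_def A2_def c_def E_def D_def Let_def ..
  have "0 \<le> A1" "0 \<le> A2"
    using c E \<open>1 \<le> A\<close> \<open>0 \<le> B\<close> C_pos l_nonneg by (auto simp: A1_def A2_def)
  have length: "I 0 L \<le> A1 * Y.d y y'"
  proof -
    have "I 0 L \<le> c * S 0 (Suc n)" using I_le[of 0 "Suc n"] by (simp add: L_def)
    also have "\<dots> \<le> c * ((1 + E) * S 0 n)"
      using final[OF \<open>0 < n\<close>] c by (intro mult_left_mono) (auto simp: S_def algebra_simps)
    also have "\<dots> \<le> c * ((1 + E) * (E * A * X.d (\<phi> y) (\<phi> y')))"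
      using total c E by (intro mult_left_mono) auto
    also have "\<dots> \<le> c * ((1 + E) * (E * A * ((exp (k * (1 + l)) * (1 + l) * C * (1 + E) * E) * Y.d y y')))"
      using conformal_dist_image_le[of y y'] far l_nonneg c E \<open>1 \<le> A\<close>
      by (intro mult_left_mono) (auto simp: E_def)
    finally show ?thesis by (simp add: A1_def mult.assoc)
  qed
  have center: "min (I 0 s) (I s L) \<le> A2 * \<rho>\<^sub>Y (g s)" if s: "s \<in> {0..L}" for s
  proof -
    (* The endpoint s = L belongs to the last piece, i = n. *)
    obtain i where i: "i \<le> n" "s \<in> {real i * D..real (Suc i) * D}"
    proof (cases "s = L")
      case True
      then show thesis using that[of n] D by (auto simp: L_def mult_right_mono)
    next
      case False
      define i where "i = nat \<lfloor>s / D\<rfloor>"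
      have "0 \<le> s / D" using s D by simp
      then have "real i \<le> s / D" "s / D < real i + 1" by (auto simp: i_def)
      then have *: "real i * D \<le> s" "s < real (Suc i) * D" using D by (auto simp: field_simps)
      have "real i * D < real (Suc n) * D" using * s False by (auto simp: L_def)
      then have "i \<le> n" using D by (simp add: mult_less_cancel_right)
      then show thesis using that[of i] * by simp
    qed
    have before: "I 0 s \<le> c * (S 0 i + r i)"
    proof -
      have "I 0 s \<le> I (real 0 * D) (real (Suc i) * D)"
        using s i iD[of "Suc i"] by (intro I_mono) auto
      also have "\<dots> \<le> c * S 0 (Suc i)" using i by (intro I_le) auto
      finally show ?thesis by (simp add: S_def)
    qed
    have after: "I s L \<le> c * ((1 + E) * S i n + r i)"
    proof -
      have "I s L \<le> I (real i * D) (real (Suc n) * D)"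
        using s i iD[of i] by (intro I_mono) (auto simp: L_def)
      also have "\<dots> \<le> c * S i (Suc n)" using i by (intro I_le) auto
      also have "\<dots> \<le> c * ((1 + E) * S i n + r i)" using last[OF i(1)] c by simp
      finally show ?thesis .
    qed
    define m where "m = min (S 0 i) (S i n)"
    have "min (I 0 s) (I s L) \<le> c * ((1 + E) * m + r i)"
    proof (cases "S 0 i \<le> S i n")
      case True
      have "S 0 i \<le> (1 + E) * S 0 i" using mult_right_mono[of 1 "1 + E" "S 0 i"] E S_nonneg by simp
      then have "c * (S 0 i + r i) \<le> c * ((1 + E) * S 0 i + r i)" using c by simp
      then show ?thesis using before True by (simp add: m_def min_def)
    next
      case False
      then show ?thesis using after by (simp add: m_def min_def)
    qed
    also have "\<dots> \<le> c * ((1 + E) * (E * A * B * r i) + (1 + E) * r i)"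
      using middle[OF i(1)] c E r[of i] mult_right_mono[of 1 "1 + E" "r i"]
      by (intro mult_left_mono add_mono) (auto simp: m_def)
    also have "\<dots> = c * (1 + E) * (1 + E * A * B) * r i" by (simp add: algebra_simps)
    also have "\<dots> \<le> c * (1 + E) * (1 + E * A * B) * (exp (k * \<tau>) * (C * (exp (k * D) * \<rho>\<^sub>Y (g s))))"
    proof (rule mult_left_mono)
      have "r i \<le> exp (k * \<tau>) * \<rho>\<^sub>X (\<phi> (q i))"
        unfolding r_def by (rule X.harnack_le[OF q\<gamma>[OF i(1)]])
      also have "\<dots> \<le> exp (k * \<tau>) * (C * \<rho>\<^sub>Y (q i))" by (intro mult_left_mono \<rho>\<^sub>X_le) auto
      also have "\<dots> \<le> exp (k * \<tau>) * (C * (exp (k * D) * \<rho>\<^sub>Y (g s)))"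
        using gd[OF i] C_pos by (intro mult_left_mono Y.harnack_le) (auto simp: dist_commute)
      finally show "r i \<le> exp (k * \<tau>) * (C * (exp (k * D) * \<rho>\<^sub>Y (g s)))" .
    qed (use c E \<open>1 \<le> A\<close> \<open>0 \<le> B\<close> in auto)
    finally show ?thesis by (simp add: A2_def mult.assoc)
  qed
  have "Y.uniform_curve (max A1 A2) y y'"
    unfolding Y.uniform_curve_def
  proof (intro exI[of _ L] exI[of _ g] conjI ballI)
    show "g 0 = y" "g L = y'" using gq[of 0] gq[of "Suc n"] q0 by (auto simp: L_def)
    show "integral {0..L} (\<lambda>s. \<rho>\<^sub>Y (g s)) \<le> max A1 A2 * Y.d y y'"
      using order_trans[OF length mult_right_mono[of A1 "max A1 A2"]] Y.d_nonneg by (simp add: I_def)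
    show "min (integral {0..s} (\<lambda>s. \<rho>\<^sub>Y (g s))) (integral {s..L} (\<lambda>s. \<rho>\<^sub>Y (g s))) \<le> max A1 A2 * \<rho>\<^sub>Y (g s)"
      if "s \<in> {0..L}" for s
      using order_trans[OF center[OF that] mult_right_mono[of A2 "max A1 A2"]] Y.nonneg
      by (simp add: I_def)
  qed (use L g in auto)
  then show ?thesis
    unfolding A12 by (rule Y.uniform_curve_mono) (use \<open>0 \<le> A1\<close> \<open>0 \<le> A2\<close> in auto)
qed

theorem uniform_metric_space_transfer:
  assumes unif: "uniform_metric_space UNIV X.d"
    and bdry: "\<And>x. dist_to_boundary UNIV X.d x \<le> B * \<rho>\<^sub>X x"
    and ncomp: "\<not> Y.M.mcomplete"
  shows "uniform_metric_space UNIV Y.d"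
proof -
  obtain A where A: "1 \<le> A" "uniform_metric_space_with A UNIV X.d"
    using unif unfolding uniform_metric_space_def by blast
  have bdry': "dist_to_boundary UNIV X.d x \<le> max 0 B * \<rho>\<^sub>X x" for x
    using order_trans[OF bdry mult_right_mono[of B "max 0 B"]] X.nonneg by simp
  define R where "R = 1 + l"
  define A' where "A' = max (far_const A (max 0 B)) (exp (k * R) * exp (k * R) * exp k * R)"
  have "Y.uniform_curve A' y y'" for y y'
  proof (cases "dist y y' \<le> R")
    case True
    then show ?thesis
      using Y.uniform_curve_mono[OF Y.uniform_curve_near, of R y y' A'] l_nonneg
      by (simp add: A'_def R_def)
  next
    case False
    then show ?thesis
      using Y.uniform_curve_mono[OF uniform_curve_far[OF A(2,1) _ bdry'], of y y' A']
      by (simp add: A'_def R_def)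
  qed
  then show ?thesis by (rule Y.uniform_metric_spaceI[OF ncomp])
qed

end

section \<open>Gromov products and Busemann functions\<close>

lemma gromov_product_commute: "gromov_product p x y = gromov_product p y x"
  by (simp add: gromov_product_def dist_commute)

lemma gromov_product_bounds: "0 \<le> gromov_product p x y" "gromov_product p x y \<le> dist x p"
  using dist_triangle2[of x y p] dist_triangle2[of y p x]
  by (auto simp: gromov_product_def dist_commute)

lemma gromov_product_base_le: "gromov_product p x y \<le> gromov_product q x y + dist p q"
  using dist_triangle[of x p q] dist_triangle[of y p q] dist_commute[of q p]
  unfolding gromov_product_def add_divide_distrib diff_divide_distrib by linarith

lemma gromov_product_point_le: "gromov_product p x z \<le> gromov_product p y z + dist x y"
  using dist_triangle[of x p y] dist_triangle[of y z x] dist_commute[of y x]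
  unfolding gromov_product_def add_divide_distrib diff_divide_distrib by linarith

definition gromov_divergent :: "(nat \<Rightarrow> 'a::metric_space) \<Rightarrow> (nat \<Rightarrow> 'a) \<Rightarrow> bool" where
  "gromov_divergent u v \<longleftrightarrow> (\<forall>p Z. \<exists>N. \<forall>m\<ge>N. \<forall>n\<ge>N. Z \<le> gromov_product p (u m) (v n))"

lemma gromov_rel_iff:
  "(u, v) \<in> gromov_rel \<longleftrightarrow> gromov_divergent u u \<and> gromov_divergent v v \<and> gromov_divergent u v"
proof -
  have "(\<forall>p. filterlim (\<lambda>(m, n). gromov_product p (u m) (v n)) at_top (sequentially \<times>\<^sub>F sequentially))
    \<longleftrightarrow> gromov_divergent u v" for u v :: "nat \<Rightarrow> 'a"
    unfolding filterlim_at_top eventually_prod_sequentially gromov_divergent_def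
    by (simp add: split_beta) blast
  then show ?thesis by (simp add: gromov_rel_def gromov_sequence_def)
qed

lemma gromov_sequence_iff: "gromov_sequence u \<longleftrightarrow> gromov_divergent u u"
  using gromov_rel_iff[of u u] by (auto simp: gromov_rel_def gromov_sequence_def)

lemma gromov_divergent_sym: "gromov_divergent u v \<Longrightarrow> gromov_divergent v u"
  unfolding gromov_divergent_def by (metis gromov_product_commute)

lemma gromov_divergent_trans:
  fixes u v w :: "nat \<Rightarrow> 'a::metric_space"
  assumes hyp: "delta_hyperbolic \<delta> TYPE('a)" and "gromov_divergent u v" "gromov_divergent v w"
  shows "gromov_divergent u w"
  unfolding gromov_divergent_def
proof (intro allI)
  fix p :: 'a and Z
  obtain N1 where N1: "\<And>m n. m \<ge> N1 \<Longrightarrow> n \<ge> N1 \<Longrightarrow> Z + \<delta> \<le> gromov_product p (u m) (v n)"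
    using assms(2) unfolding gromov_divergent_def by blast
  obtain N2 where N2: "\<And>m n. m \<ge> N2 \<Longrightarrow> n \<ge> N2 \<Longrightarrow> Z + \<delta> \<le> gromov_product p (v m) (w n)"
    using assms(3) unfolding gromov_divergent_def by blast
  define N where "N = max N1 N2"
  have "Z \<le> gromov_product p (u m) (w n)" if "m \<ge> N" "n \<ge> N" for m n
  proof -
    have "gromov_product p (u m) (w n)
        \<ge> min (gromov_product p (u m) (v N)) (gromov_product p (v N) (w n)) - \<delta>"
      using hyp unfolding delta_hyperbolic_def by blast
    then show ?thesis using N1[of m N] N2[of N n] that by (simp add: N_def)
  qed
  then show "\<exists>N. \<forall>m\<ge>N. \<forall>n\<ge>N. Z \<le> gromov_product p (u m) (w n)" by blast
qed

text \<open>
  The property of a boundary point that the estimates use.  Unlike membership in the quotient it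
  passes directly to the image under a rough isometry.
\<close>

definition equivalent_sequences :: "(nat \<Rightarrow> 'a::metric_space) set \<Rightarrow> bool" where
  "equivalent_sequences \<xi> \<longleftrightarrow> \<xi> \<noteq> {} \<and> (\<forall>u\<in>\<xi>. \<forall>v\<in>\<xi>. gromov_divergent u v)"

lemma equivalent_sequences_boundary:
  fixes \<omega> :: "(nat \<Rightarrow> 'a::metric_space) set"
  assumes hyp: "delta_hyperbolic \<delta> TYPE('a)" and "\<omega> \<in> gromov_boundary"
  shows "equivalent_sequences \<omega>"
proof -
  obtain u where u: "gromov_divergent u u" "\<omega> = gromov_rel `` {u}"
    using assms(2) unfolding gromov_boundary_def quotient_def by (auto simp: gromov_sequence_iff)
  then have "u \<in> \<omega>" by (simp add: gromov_rel_iff)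
  moreover have "gromov_divergent v w" if "v \<in> \<omega>" "w \<in> \<omega>" for v w
    using that u gromov_divergent_trans[OF hyp gromov_divergent_sym, of u v w] by (auto simp: gromov_rel_iff)
  ultimately show ?thesis unfolding equivalent_sequences_def by blast
qed

text \<open>
  A rough isometry lowers Gromov products by at most \<open>3 * l / 2\<close>, and a change of base point
  changes them by at most the distance of the base points.
\<close>

lemma rough_isometry_gromov_divergent:
  assumes "rough_isometry l \<phi>" "gromov_divergent u v"
  shows "gromov_divergent (\<phi> \<circ> u) (\<phi> \<circ> v)"
  unfolding gromov_divergent_def
proof (intro allI)
  fix p Z
  fix q
  have le: "gromov_product q x y \<le> gromov_product p (\<phi> x) (\<phi> y) + (3 * l / 2 + dist (\<phi> q) p)" for x y
  proof -
    have "gromov_product q x y \<le> gromov_product (\<phi> q) (\<phi> x) (\<phi> y) + 3 * l / 2"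
    proof -
      have "dist a b - l \<le> dist (\<phi> a) (\<phi> b)" "dist (\<phi> a) (\<phi> b) \<le> dist a b + l" for a b
        using assms(1) by (auto simp: rough_isometry_def)
      from this(1)[of x q] this(1)[of y q] this(2)[of x y] show ?thesis
        unfolding gromov_product_def add_divide_distrib diff_divide_distrib by linarith
    qed
    then show ?thesis using gromov_product_base_le[of "\<phi> q" "\<phi> x" "\<phi> y" p] by linarith
  qed
  obtain N where N: "\<And>m n. m \<ge> N \<Longrightarrow> n \<ge> N \<Longrightarrow>
      Z + (3 * l / 2 + dist (\<phi> q) p) \<le> gromov_product q (u m) (v n)"
    using assms(2) unfolding gromov_divergent_def by meson
  have "Z \<le> gromov_product p ((\<phi> \<circ> u) m) ((\<phi> \<circ> v) n)" if "m \<ge> N" "n \<ge> N" for m n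
    using le[of "u m" "v n"] N[OF that] by simp
  then show "\<exists>N. \<forall>m\<ge>N. \<forall>n\<ge>N. Z \<le> gromov_product p ((\<phi> \<circ> u) m) ((\<phi> \<circ> v) n)" by blast
qed

lemma equivalent_sequences_boundary_map:
  fixes \<phi> :: "'b::metric_space \<Rightarrow> 'a::metric_space"
  assumes hyp: "delta_hyperbolic \<delta> TYPE('a)" and \<phi>: "rough_isometry l \<phi>" and \<omega>: "equivalent_sequences \<omega>"
  shows "equivalent_sequences (boundary_map \<phi> \<omega>)"
    and image_in_boundary_map: "u \<in> \<omega> \<Longrightarrow> \<phi> \<circ> u \<in> boundary_map \<phi> \<omega>"
proof -
  have div: "gromov_divergent (\<phi> \<circ> u) (\<phi> \<circ> v)" if "u \<in> \<omega>" "v \<in> \<omega>" for u v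
    using \<omega> that rough_isometry_gromov_divergent[OF \<phi>] by (auto simp: equivalent_sequences_def)
  then have img: "\<phi> \<circ> u \<in> boundary_map \<phi> \<omega>" if "u \<in> \<omega>" for u
    using that by (auto simp: boundary_map_def gromov_rel_iff)
  then show "u \<in> \<omega> \<Longrightarrow> \<phi> \<circ> u \<in> boundary_map \<phi> \<omega>" .
  have "gromov_divergent v w" if vw: "v \<in> boundary_map \<phi> \<omega>" "w \<in> boundary_map \<phi> \<omega>" for v w
  proof -
    obtain u u' where "u \<in> \<omega>" "u' \<in> \<omega>" "gromov_divergent (\<phi> \<circ> u) v" "gromov_divergent (\<phi> \<circ> u') w"
      using vw by (auto simp: boundary_map_def gromov_rel_iff)
    then show ?thesis
      using div gromov_divergent_trans[OF hyp] gromov_divergent_sym by meson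
  qed
  then show "equivalent_sequences (boundary_map \<phi> \<omega>)"
    using \<omega> img unfolding equivalent_sequences_def by blast
qed

text \<open>The Gromov product with a boundary point before its conversion to a real number.\<close>

definition lower_product :: "'a::metric_space \<Rightarrow> 'a \<Rightarrow> (nat \<Rightarrow> 'a) set \<Rightarrow> ereal" where
  "lower_product p x \<xi> = (INF u\<in>\<xi>. liminf (\<lambda>n. ereal (gromov_product p x (u n))))"

lemma lower_product_le:
  assumes "u \<in> \<xi>" "eventually (\<lambda>n. gromov_product p x (u n) \<le> c) sequentially"
  shows "lower_product p x \<xi> \<le> ereal c"
proof -
  have "lower_product p x \<xi> \<le> liminf (\<lambda>n. ereal (gromov_product p x (u n)))"
    unfolding lower_product_def using assms(1) by (rule INF_lower)
  also have "\<dots> \<le> liminf (\<lambda>n. ereal c)" using assms(2) by (intro Liminf_mono) auto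
  finally show ?thesis by (simp add: Liminf_const)
qed

lemma lower_product_ge:
  assumes "\<And>u. u \<in> \<xi> \<Longrightarrow> eventually (\<lambda>n. c \<le> gromov_product p x (u n)) sequentially"
  shows "ereal c \<le> lower_product p x \<xi>"
  unfolding lower_product_def using assms by (intro INF_greatest Liminf_bounded) auto

lemma ereal_gromov_product_bdry:
  assumes "\<xi> \<noteq> {}" shows "ereal (gromov_product_bdry p x \<xi>) = lower_product p x \<xi>"
proof -
  obtain u where "u \<in> \<xi>" using assms by blast
  have "lower_product p x \<xi> \<le> ereal (dist x p)"
    using \<open>u \<in> \<xi>\<close> by (rule lower_product_le) (simp add: gromov_product_bounds)
  moreover have "ereal 0 \<le> lower_product p x \<xi>"
    by (rule lower_product_ge) (simp add: gromov_product_bounds)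
  ultimately show ?thesis
    unfolding gromov_product_bdry_def lower_product_def[symmetric] by (cases "lower_product p x \<xi>") auto
qed

lemma gromov_product_bdry_mono:
  assumes "\<xi> \<noteq> {}" and le: "\<And>z. gromov_product p x z \<le> gromov_product q y z + c"
  shows "gromov_product_bdry p x \<xi> \<le> gromov_product_bdry q y \<xi> + c"
proof -
  have "lower_product p x \<xi> - ereal c \<le> lower_product q y \<xi>"
    unfolding lower_product_def[of q y]
  proof (rule INF_greatest)
    fix u assume "u \<in> \<xi>"
    then have "lower_product p x \<xi> \<le> liminf (\<lambda>n. ereal (gromov_product p x (u n)))"
      unfolding lower_product_def by (rule INF_lower)
    also have "\<dots> \<le> liminf (\<lambda>n. ereal (gromov_product q y (u n)) + ereal c)"
      by (intro Liminf_mono) (simp add: le)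
    also have "\<dots> = liminf (\<lambda>n. ereal (gromov_product q y (u n))) + ereal c"
      by (rule Liminf_add_ereal_right) auto
    finally show "lower_product p x \<xi> - ereal c \<le> liminf (\<lambda>n. ereal (gromov_product q y (u n)))"
      by (simp add: ereal_minus_le_iff add.commute)
  qed
  then show ?thesis
    unfolding ereal_gromov_product_bdry[OF assms(1), symmetric] by simp
qed

lemma busemann_lipschitz:
  assumes "\<xi> \<noteq> {}" shows "\<bar>busemann \<xi> p x - busemann \<xi> p y\<bar> \<le> 2 * dist x y"
proof -
  have 1: "gromov_product_bdry x p \<xi> \<le> gromov_product_bdry y p \<xi> + dist x y" for x y
    by (rule gromov_product_bdry_mono[OF assms gromov_product_base_le])
  have 2: "gromov_product_bdry p x \<xi> \<le> gromov_product_bdry p y \<xi> + dist x y" for x y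
    by (rule gromov_product_bdry_mono[OF assms gromov_product_point_le])
  show ?thesis using 1[of x y] 1[of y x] 2[of x y] 2[of y x] by (simp add: busemann_def dist_commute)
qed

text \<open>
  By hyperbolicity the products \<open>(x|u\<^sub>n)\<close> and \<open>(x|v\<^sub>m)\<close> differ by at most \<open>\<delta>\<close> as soon as
  \<open>(u\<^sub>n|v\<^sub>m)\<close> exceeds the distance from \<open>x\<close> to the base point.  Applied to \<open>v = u\<close> this controls the
  oscillation of \<open>(x|u\<^sub>n)\<close>, and applied to every other \<open>v\<close> it controls the infimum.
\<close>

lemma eventually_gromov_product_bdry:
  fixes \<xi> :: "(nat \<Rightarrow> 'a::metric_space) set"
  assumes hyp: "delta_hyperbolic \<delta> TYPE('a)" "0 \<le> \<delta>" and \<xi>: "equivalent_sequences \<xi>" and u: "u \<in> \<xi>"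
  shows "eventually (\<lambda>n. \<bar>gromov_product_bdry p x \<xi> - gromov_product p x (u n)\<bar> \<le> 2 * \<delta>) sequentially"
proof -
  have close: "\<exists>N. \<forall>m\<ge>N. \<forall>n\<ge>N. \<bar>gromov_product p x (u n) - gromov_product p x (v m)\<bar> \<le> \<delta>"
    if "v \<in> \<xi>" for v
  proof -
    obtain N where N: "\<And>m n. m \<ge> N \<Longrightarrow> n \<ge> N \<Longrightarrow> dist x p \<le> gromov_product p (u m) (v n)"
    proof -
      have "gromov_divergent u v" using \<xi> u \<open>v \<in> \<xi>\<close> by (simp add: equivalent_sequences_def)
      then show thesis using that unfolding gromov_divergent_def by meson
    qed
    have "\<bar>gromov_product p x (u n) - gromov_product p x (v m)\<bar> \<le> \<delta>" if "m \<ge> N" "n \<ge> N" for m n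
    proof -
      have h: "gromov_product p x a \<ge> min (gromov_product p x b) (gromov_product p b a) - \<delta>" for a b
        using hyp(1) unfolding delta_hyperbolic_def by blast
      show ?thesis
        using h[of "v m" "u n"] h[of "u n" "v m"] N[OF that(2,1)]
          gromov_product_bounds(2)[of p x "v m"] gromov_product_bounds(2)[of p x "u n"]
          gromov_product_commute[of p "u n" "v m"] by linarith
    qed
    then show ?thesis by blast
  qed
  obtain N0 where N0: "\<And>m n. m \<ge> N0 \<Longrightarrow> n \<ge> N0 \<Longrightarrow> \<bar>gromov_product p x (u n) - gromov_product p x (u m)\<bar> \<le> \<delta>"
    using close[OF u] by blast
  have "\<bar>gromov_product_bdry p x \<xi> - gromov_product p x (u n)\<bar> \<le> 2 * \<delta>" if n: "n \<ge> N0" for n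
  proof -
    let ?c = "gromov_product p x (u n)"
    have "lower_product p x \<xi> \<le> ereal (?c + \<delta>)"
    proof (rule lower_product_le[OF u], rule eventually_sequentiallyI[of N0])
      show "gromov_product p x (u m) \<le> ?c + \<delta>" if "N0 \<le> m" for m using N0[OF n that] by linarith
    qed
    moreover have "ereal (?c - 2 * \<delta>) \<le> lower_product p x \<xi>"
    proof (rule lower_product_ge)
      fix v assume "v \<in> \<xi>"
      then obtain N where N: "\<And>m n. m \<ge> N \<Longrightarrow> n \<ge> N \<Longrightarrow> \<bar>gromov_product p x (u n) - gromov_product p x (v m)\<bar> \<le> \<delta>"
        using close by blast
      show "eventually (\<lambda>m. ?c - 2 * \<delta> \<le> gromov_product p x (v m)) sequentially"
      proof (rule eventually_sequentiallyI[of "max N N0"])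
        fix m assume "max N N0 \<le> m"
        then show "?c - 2 * \<delta> \<le> gromov_product p x (v m)" using N[of m m] N0[of m n] n by auto
      qed
    qed
    ultimately show ?thesis
      using \<xi> hyp(2) by (simp add: ereal_gromov_product_bdry[symmetric] equivalent_sequences_def abs_le_iff)
  qed
  then show ?thesis by (rule eventually_sequentiallyI)
qed

text \<open>The products in \<open>busemann\<close> are based at \<open>x\<close> and at \<open>p\<close>; their difference is free of \<open>dist x p\<close>.\<close>

lemma eventually_busemann:
  fixes \<xi> :: "(nat \<Rightarrow> 'a::metric_space) set"
  assumes "delta_hyperbolic \<delta> TYPE('a)" "0 \<le> \<delta>" "equivalent_sequences \<xi>" "u \<in> \<xi>"
  shows "eventually (\<lambda>n. \<bar>busemann \<xi> p x - (dist (u n) x - dist (u n) p)\<bar> \<le> 4 * \<delta>) sequentially"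
  using eventually_gromov_product_bdry[OF assms, of x p] eventually_gromov_product_bdry[OF assms, of p x]
proof eventually_elim
  case (elim n)
  have "gromov_product x p (u n) - gromov_product p x (u n) = dist (u n) x - dist (u n) p"
    by (simp add: gromov_product_def dist_commute field_simps)
  then show ?case using elim unfolding busemann_def by linarith
qed

text \<open>
  Along the sequence \<open>\<gamma>(-n)\<close>, which represents \<open>\<xi>\<close>, the distance to \<open>\<gamma>(t)\<close> is \<open>n + t\<close>.
\<close>

lemma busemann_line:
  fixes \<xi> :: "(nat \<Rightarrow> 'a::metric_space) set"
  assumes "delta_hyperbolic \<delta> TYPE('a)" "0 \<le> \<delta>" "equivalent_sequences \<xi>"
    and line: "geodesic_line_joining \<gamma> \<xi> \<zeta>" and "s \<le> t"
  shows "busemann \<xi> p (\<gamma> s) + (t - s) - 8 * \<delta> \<le> busemann \<xi> p (\<gamma> t)"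
proof -
  define u where "u n = \<gamma> (- real n)" for n
  have "u \<in> \<xi>" using line by (simp add: geodesic_line_joining_def u_def[abs_def])
  note ev = eventually_busemann[OF assms(1-3) this, of p]
  have "eventually (\<lambda>n. busemann \<xi> p (\<gamma> s) + (t - s) - 8 * \<delta> \<le> busemann \<xi> p (\<gamma> t)) sequentially"
    using ev[of "\<gamma> s"] ev[of "\<gamma> t"] eventually_ge_at_top[of "nat \<lceil>\<bar>s\<bar>\<rceil>"]
  proof eventually_elim
    case (elim n)
    have "\<bar>s\<bar> \<le> real n" using elim(3) by linarith
    then have "dist (u n) (\<gamma> s) = real n + s" "dist (u n) (\<gamma> t) = real n + t"
      using line \<open>s \<le> t\<close> by (auto simp: geodesic_line_joining_def u_def)
    then show ?case using elim(1,2) by linarith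
  qed
  then show ?thesis by simp
qed

text \<open>
  Both Busemann functions are, up to a bounded error, limits of differences of distances to the
  same sequence and to its image.
\<close>

lemma busemann_rough_isometry:
  fixes \<phi> :: "'b::metric_space \<Rightarrow> 'a::metric_space"
  assumes "delta_hyperbolic \<delta> TYPE('a)" "0 \<le> \<delta>" "delta_hyperbolic \<delta>' TYPE('b)" "0 \<le> \<delta>'"
    and \<phi>: "rough_isometry l \<phi>" and \<omega>: "equivalent_sequences \<omega>"
  shows "\<bar>busemann (boundary_map \<phi> \<omega>) (\<phi> p) (\<phi> y) - busemann \<omega> p y\<bar> \<le> 4 * \<delta> + 4 * \<delta>' + 2 * l"
proof -
  obtain u where u: "u \<in> \<omega>" using \<omega> by (auto simp: equivalent_sequences_def)
  have "eventually (\<lambda>n. \<bar>busemann (boundary_map \<phi> \<omega>) (\<phi> p) (\<phi> y) - busemann \<omega> p y\<bar>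
      \<le> 4 * \<delta> + 4 * \<delta>' + 2 * l) sequentially"
    using eventually_busemann[OF assms(1,2) equivalent_sequences_boundary_map(1)[OF assms(1) \<phi> \<omega>]
        equivalent_sequences_boundary_map(2)[OF assms(1) \<phi> \<omega> u], of "\<phi> p" "\<phi> y"]
      eventually_busemann[OF assms(3,4) \<omega> u, of p y]
  proof eventually_elim
    case (elim n)
    have "\<bar>dist (\<phi> (u n)) (\<phi> z) - dist (u n) z\<bar> \<le> l" for z
      using \<phi> unfolding rough_isometry_def by (simp add: abs_le_iff) (metis add.commute diff_le_eq)
    from this[of p] this[of y] show ?case using elim by simp
  qed
  then show ?thesis by simp
qed

section \<open>Uniformity of the deformed spaces\<close>

lemma harnack_density_busemann:
  fixes \<xi> :: "(nat \<Rightarrow> 'a::metric_space) set"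
  assumes "proper_space TYPE('a)" "geodesic_space TYPE('a)" "\<xi> \<noteq> {}" "0 < \<epsilon>"
  shows "harnack_density (\<lambda>x. exp (- \<epsilon> * busemann \<xi> p x)) (2 * \<epsilon>)"
proof
  fix x y :: 'a
  have "\<epsilon> * (busemann \<xi> p y - busemann \<xi> p x) \<le> \<epsilon> * (2 * dist x y)"
    using busemann_lipschitz[OF assms(3), of p x y] assms(4) by (intro mult_left_mono) auto
  then have "- \<epsilon> * busemann \<xi> p x \<le> 2 * \<epsilon> * dist x y + - \<epsilon> * busemann \<xi> p y"
    by (simp add: algebra_simps)
  then show "exp (- \<epsilon> * busemann \<xi> p x) \<le> exp (2 * \<epsilon> * dist x y) * exp (- \<epsilon> * busemann \<xi> p y)"
    unfolding exp_add[symmetric] exp_le_cancel_iff .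
qed (use assms in auto)

lemma exp_busemann_line_decay:
  fixes \<xi> :: "(nat \<Rightarrow> 'a::metric_space) set"
  assumes "delta_hyperbolic \<delta> TYPE('a)" "0 \<le> \<delta>" "equivalent_sequences \<xi>"
    and "geodesic_line_joining \<gamma> \<xi> \<zeta>" and "0 < \<epsilon>"
  shows "exp (- \<epsilon> * busemann \<xi> p (\<gamma> (s + real n)))
    \<le> exp (8 * \<epsilon> * \<delta>) * exp (- \<epsilon> * busemann \<xi> p (\<gamma> s)) * exp (- \<epsilon>) ^ n"
proof -
  have "\<epsilon> * (busemann \<xi> p (\<gamma> s) + (s + real n - s) - 8 * \<delta>) \<le> \<epsilon> * busemann \<xi> p (\<gamma> (s + real n))"
    using busemann_line[OF assms(1-4), of s "s + real n" p] assms(5) by (intro mult_left_mono) auto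
  then have "- \<epsilon> * busemann \<xi> p (\<gamma> (s + real n))
      \<le> 8 * \<epsilon> * \<delta> + - \<epsilon> * busemann \<xi> p (\<gamma> s) + real n * - \<epsilon>"
    by (simp add: algebra_simps)
  then show ?thesis unfolding exp_of_nat_mult[symmetric] exp_add[symmetric] exp_le_cancel_iff .
qed

text \<open>
  The distance from \<open>x\<close> to the line is an infimum; the added \<open>1\<close> gives a point of the line within
  that distance without a compactness argument.
\<close>

lemma roughly_starlike_line_near:
  assumes "roughly_starlike_with K \<xi>"
  obtains \<gamma> s \<zeta> where "geodesic_line_joining \<gamma> \<xi> \<zeta>" "dist x (\<gamma> s) \<le> K + 1"
proof -
  obtain \<zeta> \<gamma> where \<gamma>: "geodesic_line_joining \<gamma> \<xi> \<zeta>" "infdist x (range \<gamma>) \<le> K"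
    using assms unfolding roughly_starlike_with_def by blast
  have "\<exists>r\<in>dist x ` range \<gamma>. r < K + 1"
    using \<gamma>(2) by (intro cInf_lessD) (auto simp: infdist_notempty)
  then show thesis using that[OF \<gamma>(1)] by (auto intro: less_imp_le)
qed

text \<open>
  A line through the \<open>(K + 1)\<close>-neighbourhood of \<open>x\<close>, followed away from \<open>\<xi>\<close>, ends at a point of
  the metric boundary whose deformed distance from \<open>x\<close> is at most a multiple of the density at \<open>x\<close>.
\<close>

lemma dist_to_boundary_busemann_le:
  fixes \<xi> :: "(nat \<Rightarrow> 'a::metric_space) set"
  assumes "proper_space TYPE('a)" "geodesic_space TYPE('a)"
    and hyp: "delta_hyperbolic \<delta> TYPE('a)" "0 \<le> \<delta>" and \<xi>: "equivalent_sequences \<xi>"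
    and star: "roughly_starlike_with K \<xi>" "0 \<le> K" and "0 < \<epsilon>"
  shows "\<exists>B. \<forall>x. dist_to_boundary UNIV (conformal_dist (\<lambda>x. exp (- \<epsilon> * busemann \<xi> p x))) x
    \<le> B * exp (- \<epsilon> * busemann \<xi> p x)"
proof -
  define \<rho> where "\<rho> x = exp (- \<epsilon> * busemann \<xi> p x)" for x
  interpret harnack_density \<rho> "2 * \<epsilon>"
    unfolding \<rho>_def[abs_def] using assms by (intro harnack_density_busemann) (auto simp: equivalent_sequences_def)
  define R where "R = K + 1"
  define H where "H = exp (8 * \<epsilon> * \<delta>) * exp (2 * \<epsilon> * R) * exp \<epsilon>"
  have "dist_to_boundary UNIV d x \<le> exp (2 * \<epsilon> * R) * R * H / (1 - exp (- \<epsilon>)) * \<rho> x" for x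
  proof -
    obtain \<gamma> s \<zeta> where \<gamma>: "geodesic_line_joining \<gamma> \<xi> \<zeta>" and s: "dist x (\<gamma> s) \<le> R"
      unfolding R_def by (rule roughly_starlike_line_near[OF star(1)])
    (* The sequence starts at x itself, so that its limit is compared with x. *)
    define z where "z n = (case n of 0 \<Rightarrow> x | Suc m \<Rightarrow> \<gamma> (s + real m))" for n
    have step: "dist (z n) (z (Suc n)) \<le> R" for n
      using s \<gamma> star(2) by (auto simp: z_def R_def geodesic_line_joining_def split: nat.split)
    have decay: "\<rho> (z n) \<le> H * \<rho> x * exp (- \<epsilon>) ^ n" for n
    proof (cases n)
      case 0
      have "1 * 1 * 1 \<le> exp (8 * \<epsilon> * \<delta>) * exp (2 * \<epsilon> * R) * exp \<epsilon>"
        using hyp(2) star(2) \<open>0 < \<epsilon>\<close> by (intro mult_mono) (auto simp: R_def)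
      then show ?thesis using 0 nonneg[of x] by (simp add: z_def H_def mult_le_cancel_right1)
    next
      case (Suc m)
      have "\<rho> (z n) \<le> exp (8 * \<epsilon> * \<delta>) * \<rho> (\<gamma> s) * exp (- \<epsilon>) ^ m"
        unfolding \<rho>_def Suc z_def using exp_busemann_line_decay[OF hyp \<xi> \<gamma> \<open>0 < \<epsilon>\<close>] by simp
      also have "\<dots> \<le> exp (8 * \<epsilon> * \<delta>) * (exp (2 * \<epsilon> * R) * \<rho> x) * exp (- \<epsilon>) ^ m"
        using harnack_le[of "\<gamma> s" x R] s by (intro mult_right_mono mult_left_mono) (auto simp: dist_commute)
      also have "exp (- \<epsilon>) ^ m = exp \<epsilon> * exp (- \<epsilon>) ^ n"
        unfolding Suc by (simp add: exp_minus)
      finally show ?thesis by (simp add: H_def mult_ac)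
    qed
    have "dist_to_boundary UNIV d (z 0) \<le> exp (2 * \<epsilon> * R) * R * (H * \<rho> x) / (1 - exp (- \<epsilon>))"
      by (rule dist_to_boundary_geometric_sequence[OF step decay]) (use \<open>0 < \<epsilon>\<close> in auto)
    then show ?thesis by (simp add: z_def mult_ac)
  qed
  then show ?thesis unfolding \<rho>_def[abs_def] by blast
qed

theorem theorem4p1:
  fixes \<phi> :: "'y::metric_space \<Rightarrow> 'x::metric_space"
    and l \<epsilon> :: real
    and \<omega> :: "(nat \<Rightarrow> 'y) set" and \<omega>' :: "(nat \<Rightarrow> 'x) set"
    and p :: 'y and p' :: 'x
    and b :: "'y \<Rightarrow> real" and b' :: "'x \<Rightarrow> real"
  assumes "proper_space TYPE('x)" and "geodesic_space TYPE('x)" and "gromov_hyperbolic TYPE('x)"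
    and "proper_space TYPE('y)" and "geodesic_space TYPE('y)" and "gromov_hyperbolic TYPE('y)"
    and "l \<ge> 0" and "rough_isometry l \<phi>"
    and "\<omega> \<in> gromov_boundary" and "\<omega>' = boundary_map \<phi> \<omega>" and "p' = \<phi> p"
    and "b = busemann \<omega> p" and "b' = busemann \<omega>' p'"
    and "roughly_starlike \<omega>'"
    and "\<epsilon> > 0"
    and "uniform_metric_space UNIV (conformal_dist (\<lambda>x. exp (- \<epsilon> * b' x)))"
  shows "uniform_metric_space UNIV (conformal_dist (\<lambda>y. exp (- \<epsilon> * b y)))"
proof -
  obtain \<delta> where \<delta>: "delta_hyperbolic \<delta> TYPE('x)" "0 \<le> \<delta>"
    using assms(3) unfolding gromov_hyperbolic_def by blast
  obtain \<delta>' where \<delta>': "delta_hyperbolic \<delta>' TYPE('y)" "0 \<le> \<delta>'"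
    using assms(6) unfolding gromov_hyperbolic_def by blast
  have \<omega>: "equivalent_sequences \<omega>" by (rule equivalent_sequences_boundary[OF \<delta>'(1) assms(9)])
  have \<omega>': "equivalent_sequences \<omega>'"
    unfolding assms(10) by (rule equivalent_sequences_boundary_map(1)[OF \<delta>(1) assms(8) \<omega>])
  define \<rho>\<^sub>X where "\<rho>\<^sub>X x = exp (- \<epsilon> * b' x)" for x
  define \<rho>\<^sub>Y where "\<rho>\<^sub>Y y = exp (- \<epsilon> * b y)" for y
  have X: "harnack_density \<rho>\<^sub>X (2 * \<epsilon>)"
    unfolding \<rho>\<^sub>X_def[abs_def] assms(13)
    using assms(1,2,15) \<omega>' by (intro harnack_density_busemann) (auto simp: equivalent_sequences_def)
  have Y: "harnack_density \<rho>\<^sub>Y (2 * \<epsilon>)"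
    unfolding \<rho>\<^sub>Y_def[abs_def] assms(12)
    using assms(4,5,15) \<omega> by (intro harnack_density_busemann) (auto simp: equivalent_sequences_def)
  obtain \<tau> where \<tau>: "0 \<le> \<tau>" "\<And>x. \<exists>y. dist x (\<phi> y) \<le> \<tau>"
    using assms(8) unfolding rough_isometry_def by blast
  have \<phi>: "dist y y' - l \<le> dist (\<phi> y) (\<phi> y')" "dist (\<phi> y) (\<phi> y') \<le> dist y y' + l" for y y'
    using assms(8) unfolding rough_isometry_def by blast+
  define a where "a = 4 * \<delta> + 4 * \<delta>' + 2 * l"
  define C where "C = exp (\<epsilon> * a)"
  have bb: "\<epsilon> * \<bar>b' (\<phi> y) - b y\<bar> \<le> \<epsilon> * a" for y
    unfolding a_def assms(10-13) using assms(15)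
    by (intro mult_left_mono busemann_rough_isometry[OF \<delta> \<delta>' assms(8) \<omega>]) auto
  have bb': "\<epsilon> * b' (\<phi> y) \<le> \<epsilon> * a + \<epsilon> * b y" "\<epsilon> * b y \<le> \<epsilon> * a + \<epsilon> * b' (\<phi> y)" for y
  proof -
    have "\<bar>\<epsilon> * b' (\<phi> y) - \<epsilon> * b y\<bar> \<le> \<epsilon> * a"
      using bb[of y] assms(15) by (simp add: abs_mult right_diff_distrib[symmetric])
    then show "\<epsilon> * b' (\<phi> y) \<le> \<epsilon> * a + \<epsilon> * b y" "\<epsilon> * b y \<le> \<epsilon> * a + \<epsilon> * b' (\<phi> y)" by linarith+
  qed
  interpret comparable_densities \<rho>\<^sub>X \<rho>\<^sub>Y "2 * \<epsilon>" \<phi> l \<tau> C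
  proof (intro comparable_densities.intro X Y comparable_densities_axioms.intro)
    show "\<rho>\<^sub>X (\<phi> y) \<le> C * \<rho>\<^sub>Y y" for y
      using bb'(2)[of y] by (simp add: \<rho>\<^sub>X_def \<rho>\<^sub>Y_def C_def exp_add[symmetric])
    show "\<rho>\<^sub>Y y \<le> C * \<rho>\<^sub>X (\<phi> y)" for y
      using bb'(1)[of y] by (simp add: \<rho>\<^sub>X_def \<rho>\<^sub>Y_def C_def exp_add[symmetric])
    show "dist y y' \<le> dist (\<phi> y) (\<phi> y') + l" for y y' using \<phi>(1)[of y y'] by simp
  qed (use \<phi> \<tau> assms(7) in auto)
  obtain K where K: "0 \<le> K" "roughly_starlike_with K \<omega>'"
    using assms(14) unfolding roughly_starlike_def by blast
  obtain B where B: "\<And>x. dist_to_boundary UNIV X.d x \<le> B * \<rho>\<^sub>X x"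
    using dist_to_boundary_busemann_le[OF assms(1,2) \<delta> \<omega>' K(2,1) assms(15), of p']
    unfolding \<rho>\<^sub>X_def[abs_def] assms(13) by blast
  (* Quasi-preimages along a line, away from \<omega>', form a Cauchy sequence without limit.  Any line
     will do, so the one near an arbitrary point is taken. *)
  have "\<not> Y.M.mcomplete"
  proof -
    obtain \<gamma> s \<zeta> where \<gamma>: "geodesic_line_joining \<gamma> \<omega>' \<zeta>" "dist undefined (\<gamma> s) \<le> K + 1"
      by (rule roughly_starlike_line_near[OF K(2)])
    obtain \<psi> where \<psi>: "\<And>x. dist x (\<phi> (\<psi> x)) \<le> \<tau>" using dense by metis
    define z where "z n = \<psi> (\<gamma> (s + real n))" for n
    have step: "dist (z n) (z (Suc n)) \<le> 1 + 2 * \<tau> + l" for n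
    proof -
      have "dist (\<gamma> (s + real n)) (\<gamma> (s + real (Suc n))) = 1"
        using \<gamma>(1) by (simp add: geodesic_line_joining_def)
      then have "dist (\<phi> (z n)) (\<phi> (z (Suc n))) \<le> \<tau> + 1 + \<tau>"
        using \<psi>[of "\<gamma> (s + real n)"] \<psi>[of "\<gamma> (s + real (Suc n))"]
          dist_triangle[of "\<phi> (z n)" "\<phi> (z (Suc n))" "\<gamma> (s + real n)"]
          dist_triangle[of "\<gamma> (s + real n)" "\<phi> (z (Suc n))" "\<gamma> (s + real (Suc n))"]
          dist_commute[of "\<phi> (z n)" "\<gamma> (s + real n)"]
        unfolding z_def by linarith
      then show ?thesis using rough_lower[of "z n" "z (Suc n)"] by linarith
    qed
    have decay: "\<rho>\<^sub>Y (z n) \<le> C * exp (2 * \<epsilon> * \<tau>) * exp (8 * \<epsilon> * \<delta>) * \<rho>\<^sub>X (\<gamma> s) * exp (- \<epsilon>) ^ n" for n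
    proof -
      have "\<rho>\<^sub>Y (z n) \<le> C * \<rho>\<^sub>X (\<phi> (z n))" by (rule \<rho>\<^sub>Y_le)
      also have "\<dots> \<le> C * (exp (2 * \<epsilon> * \<tau>) * \<rho>\<^sub>X (\<gamma> (s + real n)))"
        using \<psi> C_pos by (intro mult_left_mono X.harnack_le) (auto simp: z_def dist_commute)
      also have "\<dots> \<le> C * (exp (2 * \<epsilon> * \<tau>) * (exp (8 * \<epsilon> * \<delta>) * \<rho>\<^sub>X (\<gamma> s) * exp (- \<epsilon>) ^ n))"
        using exp_busemann_line_decay[OF \<delta> \<omega>' \<gamma>(1) assms(15), of p'] C_pos
        unfolding \<rho>\<^sub>X_def assms(13) by (intro mult_left_mono) auto
      finally show ?thesis by (simp add: mult.assoc)
    qed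
    have "0 \<le> exp (- \<epsilon>)" "exp (- \<epsilon>) < 1" using assms(15) by auto
    then show ?thesis
      using Y.MCauchy_geometric_sequence[OF step decay] Y.not_convergent_geometric_sequence[OF step decay]
      unfolding Y.M.mcomplete_def by blast
  qed
  moreover have "uniform_metric_space UNIV X.d" using assms(16) unfolding \<rho>\<^sub>X_def[abs_def] .
  ultimately have "uniform_metric_space UNIV Y.d" using B by (intro uniform_metric_space_transfer)
  then show ?thesis unfolding \<rho>\<^sub>Y_def[abs_def] .
qed

end
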